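(* For all integers $n\ge 0$ and $k\ge 0$, the space $\mathcal{D}_n^{(k)}=\bigoplus_{j=0}^{\min(k,n)} S_j\,\mathcal{D}^{(0)}_{n-j}\subseteq \mathbf{Sym}_n$ is stable under the internal product $*$. Moreover $(\mathcal{D}_n^{(k)},* )$ is a unital algebra, whose neutral element is $$P_n^{(k)}:=\sum_{i=0}^{\min(k,n)}\frac{S_1^i}{i!}\,S_{n-i}^\sharp .$$
   Context: $\mathbf{Sym}=\bigoplus_{n\ge0}\mathbf{Sym}_n$ (noncommutative symmetric functions, over $\mathbb{C}$) is the free associative unital algebra on generators $S_1,S_2,\dots$ with $\deg S_n=n$, $S_0=1$. For a composition $I=(i_1,\dots,i_r)$ of $n$, $S^I=S_{i_1}\cdots S_{i_r}$; these form a basis of $\mathbf{Sym}_n$. The internal product $*$ is the bilinear associative product on $\mathbf{Sym}$ with $F*G=0$ if $F,G$ are homogeneous of different degrees, and, for compositions $I,J$ of $n$, $S^I*S^J=\sum_M S^M$, sum over all nonnegative integer matrices $M$ with row sums $I$ and column sums $J$, where $S^M$ is the product of the $S_{m_{ij}}$ read row by row (left to right, top to bottom). $S_n$ is the unit of $(\mathbf{Sym}_n,* )$. Set $S_n^\sharp=\sum_{i=0}^n(-1)^i\frac{S_1^i}{i!}S_{n-i}$. Let $\mathcal{D}_n^{(0)}=\{F*S_n^\sharp : F\in\mathbf{Sym}_n\}$. $S_j\mathcal{D}^{(0)}_{n-j}$ denotes the set of ordinary products $S_jf$ with $f\in\mathcal{D}^{(0)}_{n-j}$. *)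

theory Defs
  imports Complex_Main "HOL-Library.Poly_Mapping" "HOL-Algebra.Ring"
begin

text \<open>
  Compositions are the words over the positive integers. With concatenation they form the free
  monoid on the positive integers, so that the monoid algebra \<open>composition \<Rightarrow>\<^sub>0 complex\<close>, with the
  convolution product of \<open>HOL-Library.Poly_Mapping\<close>, is the free associative unital algebra on
  the letters: the letter \<open>n\<close> plays the role of the generator \<open>S\<^sub>n\<close>.
\<close>

typedef composition = "{xs :: nat list. 0 \<notin> set xs}"
  morphisms parts Composition
  by (rule exI[of _ "[]"]) simp

setup_lifting type_definition_composition

instantiation composition :: monoid_add
begin
lift_definition zero_composition :: composition is "[]" by simp
lift_definition plus_composition :: "composition \<Rightarrow> composition \<Rightarrow> composition" is "(@)" by simp
instance by standard (transfer, simp)+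
end

definition weight :: "composition \<Rightarrow> nat"
  where "weight I = sum_list (parts I)"

type_synonym sym = "composition \<Rightarrow>\<^sub>0 complex"

definition scale :: "complex \<Rightarrow> sym \<Rightarrow> sym"  (infixr \<open>\<cdot>\<^sub>C\<close> 75)
  where "c \<cdot>\<^sub>C F = Poly_Mapping.map ((*) c) F"

lemma scale_conv_mult: "c \<cdot>\<^sub>C F = Poly_Mapping.single 0 c * F"
  by (simp add: scale_def mult_map_scale_conv_mult)

lemma lookup_scale: "Poly_Mapping.lookup (c \<cdot>\<^sub>C F) I = c * Poly_Mapping.lookup F I"
  by (simp add: scale_def Poly_Mapping.map.rep_eq when_def)

global_interpretation sym: vector_space scale
  by standard (simp_all add: poly_mapping_eq_iff fun_eq_iff lookup_scale lookup_add algebra_simps)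

definition Sym :: "nat \<Rightarrow> sym set"
  where "Sym n = {F. \<forall>I\<in>Poly_Mapping.keys F. weight I = n}"

definition gen :: "nat \<Rightarrow> sym"
  where "gen n = (if n = 0 then 1 else Poly_Mapping.single (Composition [n]) 1)"

text \<open>The product \<open>S\<^bsub>m\<^sub>1\<^esub> \<dots> S\<^bsub>m\<^sub>r\<^esub>\<close> for a list of natural numbers in which zeros may occur.\<close>

definition gen_prod :: "nat list \<Rightarrow> sym"
  where "gen_prod ms = prod_list (map gen ms)"

text \<open>
  For a composition \<open>I\<close>, the basis element \<open>S\<^sup>I\<close> is \<open>gen_prod (parts I)\<close>. The next lemma shows
  that \<open>Poly_Mapping.lookup F I\<close> is the coefficient of \<open>S\<^sup>I\<close> in \<open>F\<close>, which the definition of the internal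
  product relies on.
\<close>

lemma gen_prod_parts: "gen_prod (parts I) = Poly_Mapping.single I 1"
proof -
  have "gen_prod xs = Poly_Mapping.single (Composition xs) 1" if "0 \<notin> set xs" for xs
    using that
  proof (induction xs)
    case Nil
    then show ?case by (simp add: gen_prod_def zero_composition_def single_one[symmetric])
  next
    case (Cons x xs)
    then have "Composition [x] + Composition xs = Composition (x # xs)"
      by (simp add: plus_composition.abs_eq eq_onp_def)
    with Cons show ?case
      by (simp add: gen_prod_def gen_def mult_single)
  qed
  from this[of "parts I"] parts[of I] show ?thesis
    by (simp add: parts_inverse)
qed

text \<open>
  Nonnegative integer matrices with prescribed row sums \<open>I\<close> and column sums \<open>J\<close>, as lists of rows.
  Reading such a matrix row by row is \<open>concat\<close>.
\<close>

definition matrices :: "nat list \<Rightarrow> nat list \<Rightarrow> nat list list set"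
  where "matrices I J =
    {M. map sum_list M = I \<and> (\<forall>row\<in>set M. length row = length J) \<and>
        (\<forall>j<length J. (\<Sum>row\<leftarrow>M. row ! j) = J ! j)}"

lemma finite_matrices: "finite (matrices I J)"
proof -
  let ?R = "{row. set row \<subseteq> {..sum_list I} \<and> length row = length J}"
  have "matrices I J \<subseteq> {M. set M \<subseteq> ?R \<and> length M = length I}"
  proof
    fix M assume M: "M \<in> matrices I J"
    have "x \<le> sum_list I" if "row \<in> set M" "x \<in> set row" for row x
    proof -
      have "x \<le> sum_list row" by (rule member_le_sum_list) (use that(2) in auto)
      also have "\<dots> \<le> sum_list (map sum_list M)"
        by (rule member_le_sum_list) (use that(1) in auto)
      finally show ?thesis using M by (simp add: matrices_def)
    qed
    then show "M \<in> {M. set M \<subseteq> ?R \<and> length M = length I}"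
      using M by (auto simp: matrices_def)
  qed
  moreover have "finite {M. set M \<subseteq> ?R \<and> length M = length I}"
    by (intro finite_lists_length_eq) simp
  ultimately show ?thesis by (rule finite_subset)
qed

definition internal_basis :: "composition \<Rightarrow> composition \<Rightarrow> sym"
  where "internal_basis I J =
    (if weight I = weight J then \<Sum>M\<in>matrices (parts I) (parts J). gen_prod (concat M) else 0)"

definition internal :: "sym \<Rightarrow> sym \<Rightarrow> sym"  (infixl \<open>\<star>\<close> 70)
  where "F \<star> G =
    (\<Sum>I\<in>Poly_Mapping.keys F. \<Sum>J\<in>Poly_Mapping.keys G.
      (Poly_Mapping.lookup F I * Poly_Mapping.lookup G J) \<cdot>\<^sub>C internal_basis I J)"

lemma internal_gen_prod:
  "gen_prod (parts I) \<star> gen_prod (parts J) = internal_basis I J"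
  by (simp add: internal_def gen_prod_parts)

definition S_sharp :: "nat \<Rightarrow> sym"
  where "S_sharp n = (\<Sum>i\<le>n. ((-1) ^ i / fact i) \<cdot>\<^sub>C (gen 1 ^ i * gen (n - i)))"

definition D0 :: "nat \<Rightarrow> sym set"
  where "D0 n = {F \<star> S_sharp n | F. F \<in> Sym n}"

definition D_summand :: "nat \<Rightarrow> nat \<Rightarrow> sym set"
  where "D_summand n j = {gen j * f | f. f \<in> D0 (n - j)}"

definition D_space :: "nat \<Rightarrow> nat \<Rightarrow> sym set"
  where "D_space n k = {\<Sum>j\<le>min k n. g j | g. \<forall>j\<le>min k n. g j \<in> D_summand n j}"

definition P_unit :: "nat \<Rightarrow> nat \<Rightarrow> sym"
  where "P_unit n k = (\<Sum>i\<le>min k n. (1 / fact i) \<cdot>\<^sub>C (gen 1 ^ i * S_sharp (n - i)))"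

text \<open>\<open>V\<close> is the internal direct sum of the subspaces \<open>A i\<close>, for \<open>i\<close> in the finite set \<open>T\<close>.\<close>

definition is_direct_sum :: "sym set \<Rightarrow> (nat \<Rightarrow> sym set) \<Rightarrow> nat set \<Rightarrow> bool"
  where "is_direct_sum V A T \<longleftrightarrow>
    (\<forall>i\<in>T. sym.subspace (A i)) \<and>
    V = {\<Sum>i\<in>T. g i | g. \<forall>i\<in>T. g i \<in> A i} \<and>
    (\<forall>g. (\<forall>i\<in>T. g i \<in> A i) \<and> (\<Sum>i\<in>T. g i) = 0 \<longrightarrow> (\<forall>i\<in>T. g i = 0))"

text \<open>
  An associative unital complex algebra with carrier \<open>V\<close>, multiplication \<open>m\<close> and neutral element \<open>e\<close>;
  addition and scalar multiplication are those of \<open>sym\<close>. As usual for rings in \<open>HOL-Algebra\<close>, the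
  zero algebra is allowed; it does occur, as \<open>D_space 1 0\<close>.
\<close>

definition unital_algebra :: "sym set \<Rightarrow> (sym \<Rightarrow> sym \<Rightarrow> sym) \<Rightarrow> sym \<Rightarrow> bool"
  where "unital_algebra V m e \<longleftrightarrow>
    sym.subspace V \<and>
    ring \<lparr>carrier = V, monoid.mult = m, one = e, ring.zero = 0, add = (+)\<rparr> \<and>
    (\<forall>c. \<forall>F\<in>V. \<forall>G\<in>V. m (c \<cdot>\<^sub>C F) G = c \<cdot>\<^sub>C m F G \<and> m F (c \<cdot>\<^sub>C G) = c \<cdot>\<^sub>C m F G)"

end

theory Submission
  imports Defs
begin

text \<open>
  The internal product satisfies the splitting formula \<open>(F F') \<star> G = \<Sum> (F \<star> G\<^sub>1) (F' \<star> G\<^sub>2)\<close>,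
  where \<open>G\<^sub>1\<close>, \<open>G\<^sub>2\<close> run through the coproduct of \<open>G\<close> given by \<open>S\<^sub>n \<mapsto> \<Sum> S\<^sub>i \<otimes> S\<^bsub>n-i\<^esub>\<close>. Since the
  series \<open>exp(-S\<^sub>1) \<Sum> S\<^sub>n\<close> is grouplike, so is the sequence \<open>S\<^sub>n\<^sup>\<sharp>\<close>; hence \<open>D\<^sup>(\<^sup>0\<^sup>)\<close> is closed under the
  ordinary product and spanned by products of \<open>S\<^sub>n\<^sup>\<sharp>\<close> with \<open>n \<noteq> 1\<close>. Because \<open>S\<^sub>1\<^sup>\<sharp> = 0\<close>, splitting yields
  \<open>(S\<^sub>1\<^sup>a f) \<star> (S\<^sub>1\<^sup>b g) = \<delta>\<^sub>a\<^sub>b a! S\<^sub>1\<^sup>a (f \<star> g)\<close> for \<open>f\<close>, \<open>g\<close> in \<open>D\<^sup>(\<^sup>0\<^sup>)\<close>. From \<open>S\<^sub>j = \<Sum> S\<^sub>1\<^sup>i S\<^bsub>j-i\<^esub>\<^sup>\<sharp> / i!\<close> one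
  sees that \<open>D\<^sub>n\<^sup>(\<^sup>k\<^sup>)\<close> is also the sum of the spaces \<open>S\<^sub>1\<^sup>a D\<^sup>(\<^sup>0\<^sup>)\<close>, \<open>a \<le> min k n\<close>, and the product formula shows
  the rest.
\<close>

section \<open>Splittings of exponent lists and matrices\<close>

text \<open>The terms of the coproduct of the word \<open>S^J\<close>, in which each letter is
  divided into two parts. Zero parts are kept, so that \<open>A\<close>, \<open>B\<close> and
  \<open>J\<close> stay aligned position by position.\<close>

definition splits :: "nat list \<Rightarrow> (nat list \<times> nat list) set"
  where "splits J = {(A, B). length A = length J \<and> length B = length J \<and> map2 (+) A B = J}"

lemma splits_iff:
  "(A, B) \<in> splits J \<longleftrightarrow>
    length A = length J \<and> length B = length J \<and> (\<forall>i<length J. A ! i + B ! i = J ! i)"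
  by (auto simp: splits_def list_eq_iff_nth_eq)

lemma splits_cancel: "(A, B) \<in> splits J \<Longrightarrow> (A, C) \<in> splits J \<Longrightarrow> B = C"
  unfolding splits_iff by (metis add_left_cancel nth_equalityI)

lemma splits_Nil [simp]: "splits [] = {([], [])}"
  by (auto simp: splits_def)

lemma splits_Cons:
  "splits (j # J) = (\<lambda>(i, A, B). (i # A, (j - i) # B)) ` ({..j} \<times> splits J)"
proof (intro equalityI subsetI)
  fix p assume "p \<in> splits (j # J)"
  then obtain a A b B where p: "p = (a # A, b # B)" "(a # A, b # B) \<in> splits (j # J)"
    by (cases p) (auto simp: splits_def length_Suc_conv)
  then have "(A, B) \<in> splits J" "a + b = j"
    by (simp_all add: splits_def)
  then show "p \<in> (\<lambda>(i, A, B). (i # A, (j - i) # B)) ` ({..j} \<times> splits J)"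
    by (intro image_eqI[of _ _ "(a, A, B)"]) (simp_all add: p(1))
next
  fix p assume "p \<in> (\<lambda>(i, A, B). (i # A, (j - i) # B)) ` ({..j} \<times> splits J)"
  then obtain i A B where "p = (i # A, (j - i) # B)" "i \<le> j" "(A, B) \<in> splits J"
    by auto
  then show "p \<in> splits (j # J)"
    by (simp add: splits_def)
qed

lemma finite_splits [simp]: "finite (splits J)"
  by (induction J) (auto simp: splits_Cons)

lemma sum_splits_Cons:
  "(\<Sum>(A, B)\<in>splits (j # J). f A B) = (\<Sum>i\<le>j. \<Sum>(A, B)\<in>splits J. f (i # A) ((j - i) # B))"
proof -
  have "inj_on (\<lambda>(i, A, B). (i # A, (j - i) # B)) ({..j} \<times> splits J)"
    by (auto simp: inj_on_def)
  then show ?thesis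
    by (simp add: splits_Cons sum.reindex sum.cartesian_product case_prod_unfold)
qed

lemma sum_splits_append:
  "(\<Sum>(A, B)\<in>splits (I @ J). f A B) =
    (\<Sum>(A, B)\<in>splits I. \<Sum>(A', B')\<in>splits J. f (A @ A') (B @ B'))"
  by (induction I arbitrary: f) (simp_all add: sum_splits_Cons)

text \<open>Coassociativity: both sides run over the triples of lists with entrywise sum
  \<open>J\<close>.\<close>

lemma sum_splits_assoc:
  "(\<Sum>(A, R)\<in>splits J. \<Sum>(B, C)\<in>splits R. f A B C) =
    (\<Sum>(R, C)\<in>splits J. \<Sum>(A, B)\<in>splits R. f A B C)"
proof -
  let ?p = "map2 (+) :: nat list \<Rightarrow> nat list \<Rightarrow> nat list"
  have "(\<Sum>(A, R)\<in>splits J. \<Sum>(B, C)\<in>splits R. f A B C) =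
      (\<Sum>((A, R), B, C)\<in>Sigma (splits J) (\<lambda>(A, R). splits R). f A B C)"
    by (subst sum.Sigma[symmetric]) (auto simp: case_prod_unfold)
  also have "\<dots> = (\<Sum>((R, C), A, B)\<in>Sigma (splits J) (\<lambda>(R, C). splits R). f A B C)"
    by (rule sum.reindex_bij_witness[where
          i = "\<lambda>((R, C), A, B). ((A, ?p B C), B, C)" and
          j = "\<lambda>((A, R), B, C). ((?p A B, C), A, B)"])
       (auto simp: splits_iff list_eq_iff_nth_eq simp flip: add.assoc, metis add.assoc)
  also have "\<dots> = (\<Sum>(R, C)\<in>splits J. \<Sum>(A, B)\<in>splits R. f A B C)"
    by (subst sum.Sigma[symmetric]) (auto simp: case_prod_unfold)
  finally show ?thesis .
qed

text \<open>Both sides run over the 2 by 2 arrays of lists with entrywise total \<open>K\<close>;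
  the outer splitting is by rows on one side and by columns on the other.\<close>

lemma sum_splits_interchange:
  "(\<Sum>(R, R')\<in>splits K. \<Sum>(A, B)\<in>splits R. \<Sum>(C, D)\<in>splits R'. f A B C D) =
    (\<Sum>(R, R')\<in>splits K. \<Sum>(A, C)\<in>splits R. \<Sum>(B, D)\<in>splits R'. f A B C D)"
proof -
  let ?p = "map2 (+) :: nat list \<Rightarrow> nat list \<Rightarrow> nat list"
  let ?S = "Sigma (splits K) (\<lambda>(R, R'). splits R \<times> splits R')"
  have *: "(\<Sum>(R, R')\<in>splits K. \<Sum>(A, B)\<in>splits R. \<Sum>(C, D)\<in>splits R'. g A B C D) =
      (\<Sum>((R, R'), (A, B), C, D)\<in>?S. g A B C D)" for g :: "_ \<Rightarrow> _ \<Rightarrow> _ \<Rightarrow> _ \<Rightarrow> 'a"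
    by (subst sum.Sigma[symmetric]) (auto simp: case_prod_unfold sum.cartesian_product)
  have "(\<Sum>((R, R'), (A, B), C, D)\<in>?S. f A B C D) = (\<Sum>((R, R'), (A, C), B, D)\<in>?S. f A B C D)"
    by (rule sum.reindex_bij_witness[where
          i = "\<lambda>((R, R'), (A, C), B, D). ((?p A B, ?p C D), (A, B), C, D)" and
          j = "\<lambda>((R, R'), (A, B), C, D). ((?p A C, ?p B D), (A, C), B, D)"])
       (auto simp: splits_iff list_eq_iff_nth_eq add_ac)
  then show ?thesis
    by (simp only: * [of f] *[of "\<lambda>A C B D. f A B C D"])
qed

text \<open>The counit law: a left part that vanishes everywhere forces the right part to be
  \<open>J\<close>.\<close>

lemma sum_splits_zero:
  "(\<Sum>(A, B)\<in>splits J. if \<forall>x\<in>set A. x = 0 then f A B else 0) = f (replicate (length J) 0) J"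
proof -
  have "(\<Sum>(A, B)\<in>splits J. if \<forall>x\<in>set A. x = 0 then f A B else 0) =
    (\<Sum>p\<in>splits J. if p = (replicate (length J) 0, J) then f (replicate (length J) 0) J else 0)"
  proof (intro sum.cong refl, clarify)
    fix A B assume "(A, B) \<in> splits J"
    moreover from this have "A = replicate (length J) 0 \<longleftrightarrow> (\<forall>x\<in>set A. x = 0)"
      by (auto simp: splits_iff list_eq_iff_nth_eq all_set_conv_all_nth)
    moreover have "B = J" if "A = replicate (length J) 0"
      using \<open>(A, B) \<in> splits J\<close> that by (auto simp: splits_iff list_eq_iff_nth_eq)
    ultimately show "(if \<forall>x\<in>set A. x = 0 then f A B else 0) =
      (if (A, B) = (replicate (length J) 0, J) then f (replicate (length J) 0) J else 0)"
      by auto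
  qed
  also have "\<dots> = f (replicate (length J) 0) J"
    by (simp add: splits_iff)
  finally show ?thesis .
qed

lemma sum_list_splits: "(A, B) \<in> splits J \<Longrightarrow> sum_list A + sum_list B = sum_list J"
proof (induction J arbitrary: A B)
  case (Cons j J)
  then show ?case by (fastforce simp: splits_Cons)
qed simp

abbreviation nonzero :: "nat list \<Rightarrow> nat list"
  where "nonzero \<equiv> filter ((<) 0)"

text \<open>A zero letter splits only as \<open>0 + 0\<close>, which an \<open>f\<close> blind to
  zeros does not see. This connects lists with zeros to compositions.\<close>

lemma sum_splits_nonzero:
  assumes "\<And>A B. f (nonzero A) (nonzero B) = f A B"
  shows "(\<Sum>(A, B)\<in>splits (nonzero J). f A B) = (\<Sum>(A, B)\<in>splits J. f A B)"
  using assms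
proof (induction J arbitrary: f)
  case (Cons j J)
  \<comment> \<open>The hypothesis on \<open>f\<close> passes to the function with fixed first
    letters, as the induction hypothesis requires: both sides agree after deleting all
    zeros.\<close>
  have cons: "f (i # nonzero A) (k # nonzero B) = f (i # A) (k # B)" for i k A B
  proof -
    have "f (nonzero (i # nonzero A)) (nonzero (k # nonzero B)) = f (nonzero (i # A)) (nonzero (k # B))"
      by simp
    then show ?thesis
      by (simp only: Cons.prems)
  qed
  have *: "(\<Sum>(A, B)\<in>splits (nonzero J). f (i # A) (k # B)) =
      (\<Sum>(A, B)\<in>splits J. f (i # A) (k # B))" for i k
    by (rule Cons.IH[of "\<lambda>A B. f (i # A) (k # B)", OF cons])
  have zero: "f (0 # A) (0 # B) = f A B" for A B
  proof -
    have "f (nonzero (0 # A)) (nonzero (0 # B)) = f (nonzero A) (nonzero B)"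
      by simp
    then show ?thesis
      by (simp only: Cons.prems)
  qed
  then show ?case
    using * [of 0 0] by (cases "j = 0") (simp_all add: sum_splits_Cons * zero)
qed simp

section \<open>Matrices with given row and column sums, peeled off row by row\<close>

lemma matrices_Nil: "matrices [] J = (if \<forall>x\<in>set J. x = 0 then {[]} else {})"
proof -
  have "(\<forall>x\<in>set J. x = 0) \<longleftrightarrow> (\<forall>j<length J. J ! j = 0)"
    by (rule all_set_conv_all_nth)
  then show ?thesis
    by (auto simp: matrices_def)
qed

text \<open>The first row is the left part of a splitting of the column sums; the right part is left
  over as the column sums of the remaining rows.\<close>

lemma matrices_Cons:
  "matrices (i # I) J =
    (\<lambda>(p, M). fst p # M) ` Sigma {p \<in> splits J. sum_list (fst p) = i} (\<lambda>p. matrices I (snd p))"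
proof (intro equalityI subsetI)
  fix M assume "M \<in> matrices (i # I) J"
  then obtain r M' where M: "M = r # M'" "r # M' \<in> matrices (i # I) J"
    by (auto simp: matrices_def Cons_eq_map_conv)
  let ?R = "map (\<lambda>j. \<Sum>row\<leftarrow>M'. row ! j) [0..<length J]"
  have "(r, ?R) \<in> splits J" "sum_list r = i" "M' \<in> matrices I ?R"
    using M(2) by (auto simp: matrices_def splits_iff)
  with M(1) show "M \<in> (\<lambda>(p, M). fst p # M) `
      Sigma {p \<in> splits J. sum_list (fst p) = i} (\<lambda>p. matrices I (snd p))"
    by (intro image_eqI[of _ _ "((r, ?R), M')"]) auto
qed (auto simp: matrices_def splits_iff)

text \<open>Allowing any \<open>f\<close> in place of \<open>gen_prod\<close> keeps the recursion
  closed: peeling off a row \<open>r\<close> turns \<open>f\<close> into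
  \<open>\<lambda>X. f (r @ X)\<close>.\<close>

definition matrix_sum :: "(nat list \<Rightarrow> 'a::comm_monoid_add) \<Rightarrow> nat list \<Rightarrow> nat list \<Rightarrow> 'a"
  where "matrix_sum f I J = (\<Sum>M\<in>matrices I J. f (concat M))"

lemma matrix_sum_Nil: "matrix_sum f [] J = (if \<forall>x\<in>set J. x = 0 then f [] else 0)"
  by (simp add: matrix_sum_def matrices_Nil del: neq0_conv)

lemma matrix_sum_Cons:
  "matrix_sum f (i # I) J =
    (\<Sum>(r, R)\<in>splits J. if sum_list r = i then matrix_sum (\<lambda>X. f (r @ X)) I R else 0)"
proof -
  let ?S = "{p \<in> splits J. sum_list (fst p) = i}"
  have "inj_on (\<lambda>(p, M). fst p # M) (Sigma ?S (\<lambda>p. matrices I (snd p)))"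
    by (auto simp: inj_on_def dest: splits_cancel)
  then have "matrix_sum f (i # I) J =
      (\<Sum>(p, M)\<in>Sigma ?S (\<lambda>p. matrices I (snd p)). f (fst p @ concat M))"
    by (simp add: matrix_sum_def matrices_Cons sum.reindex case_prod_unfold)
  also have "\<dots> = (\<Sum>p\<in>?S. \<Sum>M\<in>matrices I (snd p). f (fst p @ concat M))"
    by (subst sum.Sigma) (auto simp: finite_matrices)
  finally show ?thesis
    unfolding matrix_sum_def by (simp add: sum.inter_filter case_prod_unfold)
qed

lemma matrix_sum_swap:
  "matrix_sum (\<lambda>X. \<Sum>a\<in>T. f a X) I J = (\<Sum>a\<in>T. matrix_sum (f a) I J)"
  by (simp add: matrix_sum_def sum.swap[of _ T])

lemma matrix_sum_if:
  "matrix_sum (\<lambda>X. if P then f X else 0) I J = (if P then matrix_sum f I J else 0)"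
  by (simp add: matrix_sum_def)

text \<open>The combinatorial form of \<open>\<Delta>(G \<star> H) = \<Delta>G \<star> \<Delta>H\<close>; associativity of \<open>\<star>\<close> rests on it.\<close>

lemma matrix_sum_splits:
  "matrix_sum (\<lambda>Z. \<Sum>(X, Y)\<in>splits Z. f X Y) J K =
    (\<Sum>(A, B)\<in>splits J. \<Sum>(C, D)\<in>splits K. matrix_sum (\<lambda>X. matrix_sum (f X) B D) A C)"
proof (induction J arbitrary: K f)
  case Nil
  have "(\<Sum>(C, D)\<in>splits K. matrix_sum (\<lambda>X. matrix_sum (f X) [] D) [] C) =
      (if \<forall>x\<in>set K. x = 0 then f [] [] else 0)"
    unfolding matrix_sum_Nil by (subst sum_splits_zero) simp
  then show ?case by (simp add: matrix_sum_Nil[of _ K] del: neq0_conv)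
next
  case (Cons j J)
  define h where "h A B x y C D = matrix_sum (\<lambda>X. matrix_sum (\<lambda>Y. f (x @ X) (y @ Y)) B D) A C"
    for A B x y C D
  \<comment> \<open>If the first row \<open>r = x + y\<close> has sum \<open>j\<close>, then
    \<open>x\<close> has sum \<open>a\<close> and \<open>y\<close> has sum \<open>j - a\<close> for
    exactly one \<open>a \<le> j\<close>; these become the first row sums of the two matrices on the
    right.\<close>
  have degree: "(if a' + b' = j then c else 0) =
      (\<Sum>a\<le>j. if a' = a then if b' = j - a then c else 0 else 0)" for a' b' and c :: 'a
    by auto
  \<comment> \<open>Splitting the row reading splits the first row \<open>r\<close> and the rest
    separately; the induction hypothesis handles the rest.\<close>
  have "matrix_sum (\<lambda>Z. \<Sum>(X, Y)\<in>splits Z. f X Y) (j # J) K =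
    (\<Sum>(r, R)\<in>splits K. \<Sum>(x, y)\<in>splits r. if sum_list r = j then
      \<Sum>(A, B)\<in>splits J. \<Sum>(C, D)\<in>splits R. h A B x y C D else 0)"
    unfolding matrix_sum_Cons sum_splits_append h_def Cons.IH[symmetric]
    by (intro sum.cong refl) (auto simp: case_prod_unfold matrix_sum_swap[symmetric])
  also have "\<dots> = (\<Sum>(r, R)\<in>splits K. \<Sum>(x, y)\<in>splits r. \<Sum>(A, B)\<in>splits J. \<Sum>(C, D)\<in>splits R.
      if sum_list x + sum_list y = j then h A B x y C D else 0)"
    by (intro sum.cong refl) (auto simp: sum_list_splits intro!: sum.cong)
  also have "\<dots> = (\<Sum>(A, B)\<in>splits J. \<Sum>(r, R)\<in>splits K. \<Sum>(x, y)\<in>splits r. \<Sum>(C, D)\<in>splits R.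
      if sum_list x + sum_list y = j then h A B x y C D else 0)"
    by (simp add: case_prod_unfold sum.swap[of _ _ "splits J"])
  \<comment> \<open>Instead of separating the first row from the rest and then splitting each, the
    column sums are split first and a first row is separated from each half.\<close>
  also have "\<dots> = (\<Sum>(A, B)\<in>splits J. \<Sum>(R, R')\<in>splits K. \<Sum>(x, C)\<in>splits R. \<Sum>(y, D)\<in>splits R'.
      if sum_list x + sum_list y = j then h A B x y C D else 0)"
    by (subst sum_splits_interchange) simp
  also have "\<dots> = (\<Sum>(A, B)\<in>splits J. \<Sum>(R, R')\<in>splits K. \<Sum>(x, C)\<in>splits R. \<Sum>(y, D)\<in>splits R'.
      \<Sum>a\<le>j. if sum_list x = a then if sum_list y = j - a then h A B x y C D else 0 else 0)"
    by (simp only: degree)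
  also have "\<dots> = (\<Sum>a\<le>j. \<Sum>(A, B)\<in>splits J. \<Sum>(R, R')\<in>splits K. \<Sum>(x, C)\<in>splits R. \<Sum>(y, D)\<in>splits R'.
      if sum_list x = a then if sum_list y = j - a then h A B x y C D else 0 else 0)"
    by (simp add: case_prod_unfold sum.swap[of _ _ "{..j}"])
  also have "\<dots> = (\<Sum>a\<le>j. \<Sum>(A, B)\<in>splits J. \<Sum>(C, D)\<in>splits K.
      matrix_sum (\<lambda>X. matrix_sum (f X) ((j - a) # B) D) (a # A) C)"
    unfolding matrix_sum_Cons h_def
    by (auto simp: case_prod_unfold matrix_sum_swap matrix_sum_if intro!: sum.cong)
  finally show ?case
    by (simp only: sum_splits_Cons)
qed

section \<open>The internal product on words with zeros\<close>

abbreviation sym_linear :: "(sym \<Rightarrow> sym) \<Rightarrow> bool"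
  where "sym_linear \<equiv> Vector_Spaces.linear (\<cdot>\<^sub>C) (\<cdot>\<^sub>C)"

lemma sym_linear_iff:
  "sym_linear f \<longleftrightarrow> (\<forall>F G. f (F + G) = f F + f G) \<and> (\<forall>c F. f (c \<cdot>\<^sub>C F) = c \<cdot>\<^sub>C f F)"
  by (simp add: Vector_Spaces.linear_iff sym.vector_space_axioms)

lemma sym_linear_add: "sym_linear f \<Longrightarrow> f (F + G) = f F + f G"
  and sym_linear_scale: "sym_linear f \<Longrightarrow> f (c \<cdot>\<^sub>C F) = c \<cdot>\<^sub>C f F"
  by (simp_all add: sym_linear_iff)

lemma sym_linear_sum: "sym_linear f \<Longrightarrow> f (\<Sum>i\<in>T. g i) = (\<Sum>i\<in>T. f (g i))"
  by (rule module_hom.sum[of "(\<cdot>\<^sub>C)" "(\<cdot>\<^sub>C)"]) (rule Vector_Spaces.linear.axioms(3))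

lemma sym_linear_0: "sym_linear f \<Longrightarrow> f 0 = 0"
  using sym_linear_sum[of f _ "{}"] by simp

lemma sum_single: "F = (\<Sum>I\<in>Poly_Mapping.keys F. Poly_Mapping.single I (Poly_Mapping.lookup F I))"
proof (rule poly_mapping_eqI)
  fix J
  have "Poly_Mapping.lookup (\<Sum>I\<in>Poly_Mapping.keys F. Poly_Mapping.single I (Poly_Mapping.lookup F I)) J =
      (\<Sum>I\<in>Poly_Mapping.keys F. if I = J then Poly_Mapping.lookup F J else 0)"
    unfolding lookup_sum by (intro sum.cong refl) (auto simp: lookup_single when_def)
  then show "Poly_Mapping.lookup F J =
      Poly_Mapping.lookup (\<Sum>I\<in>Poly_Mapping.keys F. Poly_Mapping.single I (Poly_Mapping.lookup F I)) J"
    by (simp add: in_keys_iff)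
qed

lemma sum_gen_prod_parts:
  "F = (\<Sum>I\<in>Poly_Mapping.keys F. Poly_Mapping.lookup F I \<cdot>\<^sub>C gen_prod (parts I))"
  by (subst sum_single) (simp add: gen_prod_parts scale_conv_mult mult_single)

lemma scale_mult_left [simp]: "(c \<cdot>\<^sub>C F) * G = c \<cdot>\<^sub>C (F * G)"
  by (simp add: scale_conv_mult mult.assoc)

lemma scale_mult_right [simp]: "F * (c \<cdot>\<^sub>C G) = c \<cdot>\<^sub>C (F * G)"
proof -
  \<comment> \<open>A scalar is a multiple of the empty word, which commutes with every
    word.\<close>
  have "F * Poly_Mapping.single 0 c = Poly_Mapping.single 0 c * F"
    by (subst (1 2) sum_single)
      (simp add: sum_distrib_left sum_distrib_right mult_single mult.commute)
  then show ?thesis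
    by (simp add: scale_conv_mult flip: mult.assoc)
qed

lemma sym_linear_mult_left: "sym_linear (\<lambda>F. H * F)"
  by (simp add: sym_linear_iff distrib_left)

definition lin_ext :: "(composition \<Rightarrow> sym) \<Rightarrow> sym \<Rightarrow> sym"
  where "lin_ext h F = (\<Sum>I\<in>Poly_Mapping.keys F. Poly_Mapping.lookup F I \<cdot>\<^sub>C h I)"

lemma lin_ext_superset:
  "finite T \<Longrightarrow> Poly_Mapping.keys F \<subseteq> T \<Longrightarrow> lin_ext h F = (\<Sum>I\<in>T. Poly_Mapping.lookup F I \<cdot>\<^sub>C h I)"
  unfolding lin_ext_def by (intro sum.mono_neutral_left) (auto simp: in_keys_iff)

lemma sym_linear_lin_ext: "sym_linear (lin_ext h)"
  unfolding sym_linear_iff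
proof (intro conjI allI)
  fix F G :: sym
  let ?T = "Poly_Mapping.keys F \<union> Poly_Mapping.keys G"
  have *: "lin_ext h H = (\<Sum>I\<in>?T. Poly_Mapping.lookup H I \<cdot>\<^sub>C h I)"
    if "Poly_Mapping.keys H \<subseteq> ?T" for H :: sym
    using that by (intro lin_ext_superset) auto
  show "lin_ext h (F + G) = lin_ext h F + lin_ext h G"
    using Poly_Mapping.keys_add[of F G]
    by (simp add: * lookup_add sym.scale_left_distrib sum.distrib)
next
  fix c F
  have "Poly_Mapping.keys (c \<cdot>\<^sub>C F) \<subseteq> Poly_Mapping.keys F"
    by (auto simp: in_keys_iff lookup_scale)
  then have "lin_ext h (c \<cdot>\<^sub>C F) = (\<Sum>I\<in>Poly_Mapping.keys F. Poly_Mapping.lookup (c \<cdot>\<^sub>C F) I \<cdot>\<^sub>C h I)"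
    by (intro lin_ext_superset) auto
  then show "lin_ext h (c \<cdot>\<^sub>C F) = c \<cdot>\<^sub>C lin_ext h F"
    by (simp add: lin_ext_def lookup_scale sym.scale_sum_right)
qed

lemma lin_ext_single [simp]: "lin_ext h (Poly_Mapping.single I 1) = h I"
  by (simp add: lin_ext_def)

lemma lin_ext_add: "lin_ext (\<lambda>I. h I + h' I) F = lin_ext h F + lin_ext h' F"
  by (simp add: lin_ext_def sym.scale_right_distrib sum.distrib)

lemma lin_ext_scale: "lin_ext (\<lambda>I. c \<cdot>\<^sub>C h I) F = c \<cdot>\<^sub>C lin_ext h F"
  by (simp add: lin_ext_def sym.scale_sum_right mult.commute)

lemma Sym_linear_eqI:
  assumes "sym_linear f" "sym_linear g" "F \<in> Sym n"
    and "\<And>J. sum_list J = n \<Longrightarrow> f (gen_prod J) = g (gen_prod J)"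
  shows "f F = g F"
proof -
  have "f (gen_prod (parts I)) = g (gen_prod (parts I))" if "I \<in> Poly_Mapping.keys F" for I
    using assms(3,4) that by (auto simp: Sym_def weight_def)
  then show ?thesis
    by (subst (1 2) sum_gen_prod_parts) (simp add: assms(1,2) sym_linear_sum sym_linear_scale)
qed

lemma sym_linear_eqI:
  assumes "sym_linear f" "sym_linear g" "\<And>J. f (gen_prod J) = g (gen_prod J)"
  shows "f F = g F"
  by (subst (1 2) sum_gen_prod_parts) (simp add: assms sym_linear_sum sym_linear_scale)

section \<open>Words with zero letters, the grading and bilinearity\<close>

lemma gen_0 [simp]: "gen 0 = 1"
  by (simp add: gen_def)

lemma gen_prod_Nil [simp]: "gen_prod [] = 1"
  and gen_prod_Cons [simp]: "gen_prod (i # I) = gen i * gen_prod I"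
  and gen_prod_append [simp]: "gen_prod (I @ J) = gen_prod I * gen_prod J"
  by (simp_all add: gen_prod_def)

lemma gen_prod_nonzero [simp]: "gen_prod (nonzero J) = gen_prod J"
  by (induction J) auto

lemma parts_Composition_nonzero: "parts (Composition (nonzero J)) = nonzero J"
  by (rule Composition_inverse) auto

lemma gen_prod_conv_single: "gen_prod J = Poly_Mapping.single (Composition (nonzero J)) 1"
  by (metis gen_prod_nonzero gen_prod_parts parts_Composition_nonzero)

lemma sum_list_nonzero: "sum_list (nonzero J) = sum_list J"
  by (induction J) auto

lemma gen_prod_in_Sym: "gen_prod J \<in> Sym (sum_list J)"
  by (simp add: gen_prod_conv_single Sym_def weight_def parts_Composition_nonzero sum_list_nonzero)

lemma subspace_Sym: "sym.subspace (Sym n)"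
proof -
  have "Sym n = {F. \<forall>I. weight I \<noteq> n \<longrightarrow> Poly_Mapping.lookup F I = 0}"
    by (auto simp: Sym_def in_keys_iff)
  then show ?thesis
    by (auto simp: sym.subspace_def lookup_add lookup_scale)
qed

lemma star_conv_lin_ext: "F \<star> G = lin_ext (\<lambda>I. lin_ext (internal_basis I) G) F"
  by (simp add: internal_def lin_ext_def sym.scale_sum_right)

lemma sym_linear_star_left: "sym_linear (\<lambda>F. F \<star> G)"
  unfolding star_conv_lin_ext by (rule sym_linear_lin_ext)

lemma sym_linear_star_right: "sym_linear (\<lambda>G. F \<star> G)"
  unfolding star_conv_lin_ext sym_linear_iff
  by (simp add: sym_linear_add[OF sym_linear_lin_ext] sym_linear_scale[OF sym_linear_lin_ext]
      lin_ext_add lin_ext_scale)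

lemmas star_add_left = sym_linear_add[OF sym_linear_star_left]
  and star_add_right = sym_linear_add[OF sym_linear_star_right]
  and star_scale_left = sym_linear_scale[OF sym_linear_star_left]
  and star_scale_right = sym_linear_scale[OF sym_linear_star_right]
  and star_sum_left = sym_linear_sum[OF sym_linear_star_left]
  and star_sum_right = sym_linear_sum[OF sym_linear_star_right]
  and star_0_left [simp] = sym_linear_0[OF sym_linear_star_left]
  and star_0_right [simp] = sym_linear_0[OF sym_linear_star_right]

lemmas star_linear = star_add_left star_add_right star_scale_left star_scale_right

section \<open>Products of words as sums over matrices\<close>

abbreviation gen_sum :: "nat list \<Rightarrow> nat list \<Rightarrow> sym"
  where "gen_sum \<equiv> matrix_sum gen_prod"

lemma matrix_sum_mult_left: "matrix_sum (\<lambda>X. c * f X) I J = c * matrix_sum f I J"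
  and matrix_sum_mult_right: "matrix_sum (\<lambda>X. f X * c) I J = matrix_sum f I J * c"
  for c :: "'a::semiring_0"
  by (simp_all add: matrix_sum_def sum_distrib_left sum_distrib_right)

lemma gen_sum_Cons:
  "gen_sum (i # I) J = (\<Sum>(r, R)\<in>splits J. if sum_list r = i then gen_prod r * gen_sum I R else 0)"
  by (simp add: matrix_sum_Cons matrix_sum_mult_left cong: if_cong)

text \<open>The splitting formula on words: the upper rows, with sums \<open>I\<close>, have column
  sums \<open>A\<close>, the lower rows have column sums \<open>B\<close>, and the row reading of
  the matrix is the concatenation of the two readings.\<close>

lemma gen_sum_append: "gen_sum (I @ I') J = (\<Sum>(A, B)\<in>splits J. gen_sum I A * gen_sum I' B)"
proof (induction I arbitrary: J)
  case Nil
  have "(\<Sum>(A, B)\<in>splits J. gen_sum [] A * gen_sum I' B) =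
      (\<Sum>(A, B)\<in>splits J. if \<forall>x\<in>set A. x = 0 then gen_sum I' B else 0)"
    by (intro sum.cong) (auto simp: matrix_sum_Nil)
  then show ?case by (simp add: sum_splits_zero)
next
  case (Cons i I)
  have "gen_sum ((i # I) @ I') J = (\<Sum>(r, R)\<in>splits J. \<Sum>(A, B)\<in>splits R.
      if sum_list r = i then gen_prod r * (gen_sum I A * gen_sum I' B) else 0)"
    by (auto simp: gen_sum_Cons Cons.IH sum_distrib_left case_prod_unfold intro!: sum.cong)
  also have "\<dots> = (\<Sum>(R, B)\<in>splits J. \<Sum>(r, A)\<in>splits R.
      if sum_list r = i then gen_prod r * (gen_sum I A * gen_sum I' B) else 0)"
    by (rule sum_splits_assoc)
  also have "\<dots> = (\<Sum>(A, B)\<in>splits J. gen_sum (i # I) A * gen_sum I' B)"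
    by (auto simp: gen_sum_Cons sum_distrib_right case_prod_unfold mult.assoc intro!: sum.cong)
  finally show ?case .
qed

text \<open>A row with sum 0 consists of zeros, so it contributes the factor 1 and leaves the column
  sums as they are.\<close>

lemma gen_sum_nonzero_left: "gen_sum (nonzero I) J = gen_sum I J"
proof (induction I arbitrary: J)
  case (Cons i I)
  have "gen_sum (0 # I) J = gen_sum I J"
  proof -
    have "gen_sum (0 # I) J = (\<Sum>(r, R)\<in>splits J. if \<forall>x\<in>set r. x = 0 then gen_prod r * gen_sum I R else 0)"
      by (simp add: gen_sum_Cons)
    also have "\<dots> = gen_sum I J"
      by (subst sum_splits_zero) (simp add: gen_prod_def)
    finally show ?thesis .
  qed
  then show ?case
    using Cons.IH by (cases "i = 0") (simp_all add: gen_sum_Cons cong: if_cong)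
qed simp

lemma gen_sum_nonzero_right: "gen_sum I (nonzero J) = gen_sum I J"
proof (induction I arbitrary: J)
  case Nil
  show ?case by (auto simp: matrix_sum_Nil)
next
  case (Cons i I)
  show ?case
    unfolding gen_sum_Cons by (rule sum_splits_nonzero) (simp add: Cons.IH sum_list_nonzero cong: if_cong)
qed

text \<open>Row sums and column sums both add up to the total of all entries, so otherwise there is
  no matrix.\<close>

lemma gen_sum_eq_0: "sum_list I \<noteq> sum_list J \<Longrightarrow> gen_sum I J = 0"
proof (induction I arbitrary: J)
  case Nil
  then show ?case by (auto simp: matrix_sum_Nil)
next
  case (Cons i I)
  show ?case
    unfolding gen_sum_Cons
  proof (intro sum.neutral ballI, clarify)
    fix r R assume "(r, R) \<in> splits J"
    with Cons.prems have "sum_list I \<noteq> sum_list R" if "sum_list r = i"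
      using that by (auto simp: sum_list_splits[symmetric])
    then show "(if sum_list r = i then gen_prod r * gen_sum I R else 0) = 0"
      by (simp add: Cons.IH)
  qed
qed

text \<open>The degree condition in \<open>internal_basis\<close> is absorbed, since the sum over
  matrices vanishes for unequal degrees; zero letters can be deleted on both sides.\<close>

lemma star_gen_prod: "gen_prod I \<star> gen_prod J = gen_sum I J"
proof -
  have "gen_prod I \<star> gen_prod J = internal_basis (Composition (nonzero I)) (Composition (nonzero J))"
    by (metis gen_prod_nonzero internal_gen_prod parts_Composition_nonzero)
  also have "\<dots> = gen_sum I J"
    by (simp add: internal_basis_def weight_def parts_Composition_nonzero sum_list_nonzero gen_sum_eq_0
        gen_sum_nonzero_left gen_sum_nonzero_right flip: matrix_sum_def)
  finally show ?thesis .
qed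

lemma star_diff_degree: "F \<in> Sym m \<Longrightarrow> G \<in> Sym n \<Longrightarrow> m \<noteq> n \<Longrightarrow> F \<star> G = 0"
  unfolding internal_def by (intro sum.neutral ballI) (auto simp: Sym_def internal_basis_def)

lemma sum_list_concat_matrix: "M \<in> matrices I J \<Longrightarrow> sum_list (concat M) = sum_list I"
proof -
  have "sum_list (concat M) = sum_list (map sum_list M)"
    by (induction M) auto
  then show "M \<in> matrices I J \<Longrightarrow> sum_list (concat M) = sum_list I"
    by (auto simp: matrices_def)
qed

lemma star_in_Sym:
  assumes "F \<in> Sym n"
  shows "F \<star> G \<in> Sym n"
  unfolding internal_def
proof (intro sym.subspace_sum[OF subspace_Sym] sym.subspace_scale[OF subspace_Sym])
  fix I J assume "I \<in> Poly_Mapping.keys F"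
  then have "weight I = n"
    using assms by (auto simp: Sym_def)
  have "gen_prod (concat M) \<in> Sym n" if "M \<in> matrices (parts I) J" for M J
  proof -
    have "sum_list (concat M) = n"
      using that \<open>weight I = n\<close> by (simp add: sum_list_concat_matrix weight_def)
    then show ?thesis using gen_prod_in_Sym by metis
  qed
  then show "internal_basis I J \<in> Sym n"
    unfolding internal_basis_def
    by (auto intro: sym.subspace_sum[OF subspace_Sym] sym.subspace_0[OF subspace_Sym])
qed

lemma Sym_mult:
  assumes "F \<in> Sym m" "G \<in> Sym n"
  shows "F * G \<in> Sym (m + n)"
proof -
  have "weight (I + J) = m + n" if "weight I = m" "weight J = n" for I J
    using that by (simp add: weight_def plus_composition.rep_eq)
  then show ?thesis
    using assms Poly_Mapping.keys_mult[of F G] by (fastforce simp: Sym_def)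
qed

section \<open>Associativity and the left unit\<close>

lemma matrix_sum_all_zero:
  "matrix_sum (\<lambda>X. if \<forall>x\<in>set X. x = 0 then c else 0) I J =
    (if (\<forall>x\<in>set I. x = 0) \<and> (\<forall>x\<in>set J. x = 0) then c else 0)"
proof (induction I arbitrary: J)
  case Nil
  show ?case by (auto simp: matrix_sum_Nil)
next
  case (Cons i I)
  have "matrix_sum (\<lambda>X. if \<forall>x\<in>set X. x = 0 then c else 0) (i # I) J =
      (\<Sum>(r, R)\<in>splits J. if \<forall>x\<in>set r. x = 0 then
        if i = 0 then matrix_sum (\<lambda>X. if \<forall>x\<in>set X. x = 0 then c else 0) I R else 0 else 0)"
    unfolding matrix_sum_Cons
  proof (intro sum.cong refl, clarify)
    fix r R :: "nat list"
    let ?z = "\<lambda>X. \<forall>x\<in>set X. x = (0::nat)"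
    have append: "?z (r @ X) \<longleftrightarrow> ?z r \<and> ?z X" for X
      by auto
    show "(if sum_list r = i then matrix_sum (\<lambda>X. if ?z (r @ X) then c else 0) I R else 0) =
        (if ?z r then if i = 0 then matrix_sum (\<lambda>X. if ?z X then c else 0) I R else 0 else 0)"
    proof (cases "?z r")
      case True
      then have "sum_list r = 0"
        by (simp only: sum_list_eq_0_iff)
      from True show ?thesis
        unfolding append \<open>sum_list r = 0\<close> by (cases "i = 0") auto
    next
      case False
      then show ?thesis
        unfolding append
        by (simp only: False simp_thms if_False if_cancel matrix_sum_def sum.neutral_const)
    qed
  qed
  then show ?case
    by (subst (asm) sum_splits_zero) (auto simp: Cons.IH)
qed

text \<open>Induction on the rows of \<open>I\<close>: the first row splits \<open>J\<close>,
  \<open>gen_sum_append\<close> splits \<open>K\<close> accordingly, and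
  \<open>matrix_sum_splits\<close>, read backwards, puts both splittings together.\<close>

lemma gen_sum_assoc: "matrix_sum (\<lambda>X. gen_sum X K) I J = matrix_sum (\<lambda>Y. gen_sum I Y) J K"
proof (induction I arbitrary: J K)
  case Nil
  \<comment> \<open>With no rows, the right side tests whether all entries of a matrix vanish;
    \<open>matrix_sum_all_zero\<close> turns this into the condition that \<open>J\<close> and
    \<open>K\<close> vanish.\<close>
  show ?case
    by (simp only: matrix_sum_Nil matrix_sum_all_zero) simp
next
  case (Cons i I)
  have "matrix_sum (\<lambda>X. gen_sum X K) (i # I) J =
      (\<Sum>(A, B)\<in>splits J. \<Sum>(C, D)\<in>splits K.
        if sum_list A = i then gen_sum A C * matrix_sum (\<lambda>Y. gen_sum I Y) B D else 0)"
    unfolding matrix_sum_Cons[of _ i I J] gen_sum_append Cons.IH[symmetric]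
    by (auto simp: case_prod_unfold matrix_sum_swap matrix_sum_mult_left intro!: sum.cong)
  also have "\<dots> = (\<Sum>(A, B)\<in>splits J. \<Sum>(C, D)\<in>splits K.
      matrix_sum (\<lambda>X. matrix_sum (\<lambda>Y. if sum_list X = i then gen_prod X * gen_sum I Y else 0) B D) A C)"
  proof (intro sum.cong refl, clarify, intro sum.cong refl, clarify)
    fix A B C D
    \<comment> \<open>\<open>X\<close> reads a matrix with row sums \<open>A\<close>, so its letters
      add up to \<open>sum_list A\<close> and the condition on \<open>X\<close> becomes one on
      \<open>A\<close>.\<close>
    have "matrix_sum (\<lambda>X. matrix_sum (\<lambda>Y. if sum_list X = i then gen_prod X * gen_sum I Y else 0) B D) A C =
      matrix_sum (\<lambda>X. if sum_list A = i then gen_prod X * matrix_sum (\<lambda>Y. gen_sum I Y) B D else 0) A C"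
      unfolding matrix_sum_if matrix_sum_mult_left
      unfolding matrix_sum_def[of _ A C]
      by (auto simp: sum_list_concat_matrix intro!: sum.cong)
    then show "(if sum_list A = i then gen_sum A C * matrix_sum (\<lambda>Y. gen_sum I Y) B D else 0) =
        matrix_sum (\<lambda>X. matrix_sum (\<lambda>Y. if sum_list X = i then gen_prod X * gen_sum I Y else 0) B D) A C"
      by (simp add: matrix_sum_if matrix_sum_mult_right)
  qed
  also have "\<dots> = matrix_sum (\<lambda>Y. gen_sum (i # I) Y) J K"
    unfolding gen_sum_Cons by (rule matrix_sum_splits[symmetric])
  finally show ?case .
qed

lemma star_assoc: "(F \<star> G) \<star> H = F \<star> (G \<star> H)"
proof (rule sym_linear_eqI[of "\<lambda>F. (F \<star> G) \<star> H"])
  fix I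
  show "(gen_prod I \<star> G) \<star> H = gen_prod I \<star> (G \<star> H)"
  proof (rule sym_linear_eqI[of "\<lambda>G. (gen_prod I \<star> G) \<star> H"])
    fix J
    show "(gen_prod I \<star> gen_prod J) \<star> H = gen_prod I \<star> (gen_prod J \<star> H)"
    proof (rule sym_linear_eqI[of "\<lambda>H. (gen_prod I \<star> gen_prod J) \<star> H"])
      fix K
      have "(gen_prod I \<star> gen_prod J) \<star> gen_prod K = matrix_sum (\<lambda>X. gen_sum X K) I J"
        by (simp add: star_gen_prod matrix_sum_def[of _ I J] star_sum_left)
      moreover have "gen_prod I \<star> (gen_prod J \<star> gen_prod K) = matrix_sum (\<lambda>Y. gen_sum I Y) J K"
        by (simp add: star_gen_prod matrix_sum_def[of _ J K] star_sum_right)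
      ultimately show "(gen_prod I \<star> gen_prod J) \<star> gen_prod K = gen_prod I \<star> (gen_prod J \<star> gen_prod K)"
        by (simp add: gen_sum_assoc)
    qed (simp_all add: sym_linear_iff star_linear)
  qed (simp_all add: sym_linear_iff star_linear)
qed (simp_all add: sym_linear_iff star_linear)

text \<open>A matrix with a single row coincides with its list of column sums.\<close>

lemma gen_star:
  assumes "G \<in> Sym n"
  shows "gen n \<star> G = G"
proof (rule Sym_linear_eqI[OF _ _ assms])
  fix J assume "sum_list J = n"
  have "gen n \<star> gen_prod J = gen_sum [n] J"
    using star_gen_prod[of "[n]" J] by simp
  also have "\<dots> = (\<Sum>(A, B)\<in>splits J. if \<forall>x\<in>set B. x = 0 then if sum_list A = n then gen_prod A else 0 else 0)"
    by (auto simp: gen_sum_Cons matrix_sum_Nil intro!: sum.cong)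
  \<comment> \<open>The two parts are exchanged, because \<open>sum_splits_zero\<close> wants the
    vanishing part on the left.\<close>
  also have "\<dots> = (\<Sum>(A, B)\<in>splits J. if \<forall>x\<in>set A. x = 0 then if sum_list B = n then gen_prod B else 0 else 0)"
    by (rule sum.reindex_bij_witness[of _ prod.swap prod.swap]) (auto simp: splits_iff add.commute)
  also have "\<dots> = gen_prod J"
    using \<open>sum_list J = n\<close> by (subst sum_splits_zero) simp
  finally show "gen n \<star> gen_prod J = gen_prod J" .
qed (simp_all add: sym_linear_iff star_linear)

section \<open>The coproduct\<close>

text \<open>\<open>sweedler \<beta> G\<close> is \<open>\<Sum> \<beta> G\<^sub>1 G\<^sub>2\<close> in Sweedler notation. It replaces the tensor square of \<open>sym\<close>.\<close>

definition sweedler :: "(sym \<Rightarrow> sym \<Rightarrow> sym) \<Rightarrow> sym \<Rightarrow> sym"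
  where "sweedler \<beta> = lin_ext (\<lambda>J. \<Sum>(A, B)\<in>splits (parts J). \<beta> (gen_prod A) (gen_prod B))"

lemma sym_linear_sweedler: "sym_linear (sweedler \<beta>)"
  unfolding sweedler_def by (rule sym_linear_lin_ext)

lemmas sweedler_linear = sym_linear_add[OF sym_linear_sweedler] sym_linear_scale[OF sym_linear_sweedler]
  and sweedler_sum = sym_linear_sum[OF sym_linear_sweedler]

lemma sweedler_gen_prod:
  "sweedler \<beta> (gen_prod J) = (\<Sum>(A, B)\<in>splits J. \<beta> (gen_prod A) (gen_prod B))"
proof -
  have "sweedler \<beta> (gen_prod J) = (\<Sum>(A, B)\<in>splits (nonzero J). \<beta> (gen_prod A) (gen_prod B))"
    by (simp add: gen_prod_conv_single[of J] sweedler_def parts_Composition_nonzero)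
  also have "\<dots> = (\<Sum>(A, B)\<in>splits J. \<beta> (gen_prod A) (gen_prod B))"
    by (rule sum_splits_nonzero) simp
  finally show ?thesis .
qed

lemma sweedler_1 [simp]: "sweedler \<beta> 1 = \<beta> 1 1"
  using sweedler_gen_prod[of \<beta> "[]"] by simp

lemma sweedler_add_fun: "sweedler (\<lambda>X Y. \<beta> X Y + \<gamma> X Y) G = sweedler \<beta> G + sweedler \<gamma> G"
  by (rule sym_linear_eqI[of _ "\<lambda>G. sweedler \<beta> G + sweedler \<gamma> G"])
    (simp_all add: sym_linear_iff sweedler_linear sweedler_gen_prod case_prod_unfold sum.distrib
      sym.scale_right_distrib)

lemma sweedler_scale_fun: "sweedler (\<lambda>X Y. c \<cdot>\<^sub>C \<beta> X Y) G = c \<cdot>\<^sub>C sweedler \<beta> G"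
  by (rule sym_linear_eqI[of _ "\<lambda>G. c \<cdot>\<^sub>C sweedler \<beta> G"])
    (simp_all add: sym_linear_iff sweedler_linear sweedler_gen_prod case_prod_unfold
      sym.scale_sum_right sym.scale_right_distrib mult.commute)

lemma sweedler_0_fun: "sweedler (\<lambda>X Y. 0) G = 0"
  using sweedler_scale_fun[of 0 "\<lambda>X Y. 0" G] by simp

lemma sweedler_sum_fun: "sweedler (\<lambda>X Y. \<Sum>i\<in>T. \<beta> i X Y) G = (\<Sum>i\<in>T. sweedler (\<beta> i) G)"
  by (induction T rule: infinite_finite_induct) (simp_all add: sweedler_0_fun sweedler_add_fun)

text \<open>Trilinearity reduces the claim to words, where it is
  \<open>gen_sum_append\<close>.\<close>

lemma mult_star: "(F * F') \<star> G = sweedler (\<lambda>X Y. (F \<star> X) * (F' \<star> Y)) G"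
proof (rule sym_linear_eqI[of "\<lambda>F. (F * F') \<star> G"])
  fix I
  show "(gen_prod I * F') \<star> G = sweedler (\<lambda>X Y. (gen_prod I \<star> X) * (F' \<star> Y)) G"
  proof (rule sym_linear_eqI[of "\<lambda>F'. (gen_prod I * F') \<star> G"])
    fix I'
    show "(gen_prod I * gen_prod I') \<star> G = sweedler (\<lambda>X Y. (gen_prod I \<star> X) * (gen_prod I' \<star> Y)) G"
    proof (rule sym_linear_eqI[of "\<lambda>G. (gen_prod I * gen_prod I') \<star> G"])
      fix J
      show "(gen_prod I * gen_prod I') \<star> gen_prod J =
          sweedler (\<lambda>X Y. (gen_prod I \<star> X) * (gen_prod I' \<star> Y)) (gen_prod J)"
        by (simp add: sweedler_gen_prod star_gen_prod gen_sum_append flip: gen_prod_append)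
    qed (simp_all add: sym_linear_sweedler sym_linear_star_right)
  qed (simp_all add: sym_linear_iff star_linear distrib_left sweedler_add_fun sweedler_scale_fun)
qed (simp_all add: sym_linear_iff star_linear distrib_right sweedler_add_fun sweedler_scale_fun)

text \<open>The coproduct is multiplicative and sends \<open>S_n\<close> to the sum of the
  \<open>S_i \<otimes> S_(n-i)\<close>.\<close>

lemma sweedler_gen:
  "sweedler \<beta> (gen n * G) = (\<Sum>i\<le>n. sweedler (\<lambda>X Y. \<beta> (gen i * X) (gen (n - i) * Y)) G)"
proof (rule sym_linear_eqI[of "\<lambda>G. sweedler \<beta> (gen n * G)"])
  fix J
  show "sweedler \<beta> (gen n * gen_prod J) =
      (\<Sum>i\<le>n. sweedler (\<lambda>X Y. \<beta> (gen i * X) (gen (n - i) * Y)) (gen_prod J))"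
    using sweedler_gen_prod[of \<beta> "n # J"] by (simp add: sum_splits_Cons sweedler_gen_prod)
qed (simp_all add: sym_linear_iff sweedler_linear distrib_left sum.distrib sym.scale_sum_right)

text \<open>Pascal's rule, arranged for multiplying a binomial expansion by one more factor.\<close>

lemma sum_binomial_Suc:
  "(\<Sum>c\<le>Suc m. of_nat (Suc m choose c) \<cdot>\<^sub>C f c (Suc m - c)) =
    (\<Sum>c\<le>m. of_nat (m choose c) \<cdot>\<^sub>C f (Suc c) (m - c)) +
    (\<Sum>c\<le>m. of_nat (m choose c) \<cdot>\<^sub>C f c (Suc (m - c)))"
proof -
  have "(\<Sum>c\<le>m. of_nat (m choose c) \<cdot>\<^sub>C f c (Suc (m - c))) =
      (\<Sum>c\<le>m. of_nat (m choose c) \<cdot>\<^sub>C f c (Suc m - c))"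
    by (intro sum.cong refl) (simp add: Suc_diff_le)
  also have "\<dots> = (\<Sum>c\<le>Suc m. of_nat (m choose c) \<cdot>\<^sub>C f c (Suc m - c))"
    by (simp add: binomial_eq_0)
  also have "\<dots> = f 0 (Suc m) + (\<Sum>c\<le>m. of_nat (m choose Suc c) \<cdot>\<^sub>C f (Suc c) (m - c))"
    by (subst sum.atMost_Suc_shift) simp
  finally show ?thesis
    by (subst sum.atMost_Suc_shift) (simp add: sym.scale_left_distrib sum.distrib)
qed

text \<open>\<open>S_1\<close> is primitive and the two terms of its coproduct commute, so its
  powers expand by the binomial theorem.\<close>

lemma sweedler_gen_1_power:
  "sweedler \<beta> (gen 1 ^ m * G) =
    (\<Sum>c\<le>m. of_nat (m choose c) \<cdot>\<^sub>C sweedler (\<lambda>X Y. \<beta> (gen 1 ^ c * X) (gen 1 ^ (m - c) * Y)) G)"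
proof (induction m arbitrary: \<beta>)
  case (Suc m)
  have "sweedler \<beta> (gen 1 ^ Suc m * G) =
      sweedler (\<lambda>X Y. \<beta> (gen 1 * X) Y) (gen 1 ^ m * G) +
      sweedler (\<lambda>X Y. \<beta> X (gen 1 * Y)) (gen 1 ^ m * G)"
    using sweedler_gen[of \<beta> 1 "gen 1 ^ m * G"] by (simp add: mult.assoc add.commute)
  then show ?case
    unfolding Suc.IH sum_binomial_Suc[of m
        "\<lambda>c d. sweedler (\<lambda>X Y. \<beta> (gen 1 ^ c * X) (gen 1 ^ d * Y)) G"]
    by (simp add: mult.assoc)
qed simp

text \<open>The case of a single letter in \<open>sum_splits_interchange\<close>: arrays of four
  numbers with total \<open>n\<close>.\<close>

lemma sum_atMost_interchange:
  "(\<Sum>i\<le>n. \<Sum>a\<le>i. \<Sum>c\<le>n - i. f a (i - a) c (n - i - c)) =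
    (\<Sum>p\<le>n. \<Sum>a\<le>p. \<Sum>b\<le>n - p. f a b (p - a) (n - p - b))"
  for f :: "nat \<Rightarrow> nat \<Rightarrow> nat \<Rightarrow> nat \<Rightarrow> 'a::comm_monoid_add"
  using sum_splits_interchange[of "\<lambda>A B C D. f (hd A) (hd B) (hd C) (hd D)" "[n]"]
  by (simp add: sum_splits_Cons)

text \<open>The sequence \<open>S_sharp\<close> is grouplike, being the product of the grouplike
  series \<open>exp(-S_1)\<close> and \<open>\<Sum> S_n\<close>. Bilinearity of
  \<open>\<beta>\<close> lets the defining sums be pulled out of it.\<close>

lemma sweedler_S_sharp:
  assumes "\<And>Y. sym_linear (\<lambda>X. \<beta> X Y)" "\<And>X. sym_linear (\<beta> X)"
  shows "sweedler \<beta> (S_sharp n * G) =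
    (\<Sum>p\<le>n. sweedler (\<lambda>X Y. \<beta> (S_sharp p * X) (S_sharp (n - p) * Y)) G)"
proof -
  define c :: "nat \<Rightarrow> complex" where "c i = (-1) ^ i / fact i" for i
  define T where "T a b d e =
      sweedler (\<lambda>X Y. \<beta> (gen 1 ^ a * gen d * X) (gen 1 ^ b * gen e * Y)) G" for a b d e
  have S_sharp: "S_sharp m * X = (\<Sum>i\<le>m. c i \<cdot>\<^sub>C (gen 1 ^ i * gen (m - i) * X))" for m X
    by (simp add: S_sharp_def c_def sum_distrib_right)
  \<comment> \<open>The coefficient identity behind
    \<open>exp(-x-y) = exp(-x) exp(-y)\<close>.\<close>
  have coeff: "c i * of_nat (i choose a) = c a * c (i - a)" if "a \<le> i" for i a
  proof -
    have "(-1 :: complex) ^ i = (-1) ^ a * (-1) ^ (i - a)"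
      using that by (simp flip: power_add)
    with that show ?thesis
      by (simp add: c_def binomial_fact)
  qed
  have "sweedler \<beta> (S_sharp n * G) =
      (\<Sum>i\<le>n. c i \<cdot>\<^sub>C (\<Sum>a\<le>i. of_nat (i choose a) \<cdot>\<^sub>C (\<Sum>d\<le>n - i. T a (i - a) d (n - i - d))))"
    by (simp add: S_sharp sweedler_sum sweedler_linear sweedler_gen_1_power sweedler_gen T_def
        mult.assoc del: One_nat_def)
  also have "\<dots> = (\<Sum>i\<le>n. \<Sum>a\<le>i. \<Sum>d\<le>n - i. (c a * c (i - a)) \<cdot>\<^sub>C T a (i - a) d (n - i - d))"
    by (simp add: sym.scale_sum_right flip: coeff)
  also have "\<dots> = (\<Sum>p\<le>n. \<Sum>a\<le>p. \<Sum>b\<le>n - p. (c a * c b) \<cdot>\<^sub>C T a b (p - a) (n - p - b))"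
    by (rule sum_atMost_interchange)
  also have "\<dots> = (\<Sum>p\<le>n. sweedler (\<lambda>X Y. \<beta> (S_sharp p * X) (S_sharp (n - p) * Y)) G)"
    unfolding S_sharp T_def sym_linear_sum[OF assms(1)] sym_linear_scale[OF assms(1)]
    unfolding sym_linear_sum[OF assms(2)] sym_linear_scale[OF assms(2)]
    unfolding sweedler_sum_fun sweedler_scale_fun
    by (simp add: sym.scale_sum_right)
  finally show ?thesis .
qed

section \<open>Relations between \<open>S_sharp\<close> and the generators\<close>

lemma S_sharp_0 [simp]: "S_sharp 0 = 1"
  by (simp add: S_sharp_def)

text \<open>The terms \<open>S_1\<close> and \<open>-S_1\<close> cancel. The vanishing argument in
  \<open>sweedler_S_sharp_prod\<close> rests on this.\<close>

lemma S_sharp_1: "S_sharp (Suc 0) = 0"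
  by (simp add: S_sharp_def)

lemma gen_in_Sym: "gen n \<in> Sym n"
  using gen_prod_in_Sym[of "[n]"] by simp

lemma one_in_Sym: "1 \<in> Sym 0"
  using gen_in_Sym[of 0] by simp

lemma gen_1_power_in_Sym: "gen 1 ^ n \<in> Sym n"
  by (induction n) (use Sym_mult[OF gen_in_Sym[of 1]] one_in_Sym in auto)

lemma S_sharp_in_Sym: "S_sharp n \<in> Sym n"
  unfolding S_sharp_def
proof (intro sym.subspace_sum[OF subspace_Sym] sym.subspace_scale[OF subspace_Sym])
  fix i assume "i \<in> {..n}"
  then show "gen 1 ^ i * gen (n - i) \<in> Sym n"
    using Sym_mult[OF gen_1_power_in_Sym[of i] gen_in_Sym[of "n - i"]] by simp
qed

lemma sum_triangle:
  "(\<Sum>i\<le>n. \<Sum>l\<le>n - i. f i l) = (\<Sum>m\<le>n. \<Sum>i\<le>m. f i (m - i))"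
  for f :: "nat \<Rightarrow> nat \<Rightarrow> 'a::comm_monoid_add"
proof -
  have "(\<Sum>i\<le>n. \<Sum>l\<le>n - i. f i l) = (\<Sum>(i, l)\<in>{(i, l). i + l \<le> n}. f i l)"
    by (subst sum.Sigma) (auto intro!: sum.cong)
  then show ?thesis
    by (simp add: sum.triangle_reindex_eq)
qed

text \<open>Inverts the definition: the series \<open>exp(-S_1) \<Sum> S_n\<close> is multiplied on
  the left by \<open>exp(S_1)\<close>.\<close>

lemma gen_conv_S_sharp: "gen n = (\<Sum>i\<le>n. (1 / fact i) \<cdot>\<^sub>C (gen 1 ^ i * S_sharp (n - i)))"
proof -
  \<comment> \<open>The coefficient of \<open>x^m\<close> in \<open>exp(x) exp(-x) = 1\<close>,
    computed as \<open>(1 - 1)^m / m!\<close>.\<close>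
  have coeff: "(\<Sum>i\<le>m. 1 / fact i * ((-1) ^ (m - i) / fact (m - i)) :: complex) = (if m = 0 then 1 else 0)" for m
  proof -
    have "(\<Sum>i\<le>m. 1 / fact i * ((-1) ^ (m - i) / fact (m - i)) :: complex) =
        (\<Sum>i\<le>m. of_nat (m choose i) * 1 ^ i * (-1) ^ (m - i)) / fact m"
      unfolding sum_divide_distrib by (intro sum.cong refl) (simp add: binomial_fact)
    also have "\<dots> = (1 + -1) ^ m / fact m"
      by (simp only: binomial_ring)
    finally show ?thesis by simp
  qed
  have "(\<Sum>i\<le>n. (1 / fact i) \<cdot>\<^sub>C (gen 1 ^ i * S_sharp (n - i))) =
      (\<Sum>i\<le>n. \<Sum>l\<le>n - i. (1 / fact i * ((-1) ^ l / fact l)) \<cdot>\<^sub>C (gen 1 ^ (i + l) * gen (n - (i + l))))"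
    by (simp add: S_sharp_def sum_distrib_left sym.scale_sum_right power_add mult.assoc)
  also have "\<dots> = (\<Sum>m\<le>n. (\<Sum>i\<le>m. 1 / fact i * ((-1) ^ (m - i) / fact (m - i))) \<cdot>\<^sub>C (gen 1 ^ m * gen (n - m)))"
    unfolding sum_triangle sym.scale_sum_left by (intro sum.cong refl) simp
  also have "\<dots> = gen n"
    unfolding coeff by (simp add: if_distrib[of "\<lambda>c. c \<cdot>\<^sub>C _"] cong: if_cong)
  finally show ?thesis by simp
qed

section \<open>The product formula\<close>

definition S_sharp_prod :: "nat list \<Rightarrow> sym"
  where "S_sharp_prod I = prod_list (map S_sharp I)"

lemma gen_star_S_sharp: "gen i \<star> S_sharp n = (if i = n then S_sharp n else 0)"
  using gen_star[OF S_sharp_in_Sym] star_diff_degree[OF gen_in_Sym S_sharp_in_Sym] by auto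

text \<open>Since \<open>S_sharp\<close> is grouplike, right internal multiplication by the series
  of all \<open>S_sharp n\<close> is a homomorphism for the ordinary product.\<close>

lemma mult_star_S_sharp:
  "(F * F') \<star> S_sharp n = (\<Sum>p\<le>n. (F \<star> S_sharp p) * (F' \<star> S_sharp (n - p)))"
proof -
  have "(F * F') \<star> S_sharp n = sweedler (\<lambda>X Y. (F \<star> X) * (F' \<star> Y)) (S_sharp n * 1)"
    by (simp add: mult_star)
  also have "\<dots> = (\<Sum>p\<le>n. (F \<star> S_sharp p) * (F' \<star> S_sharp (n - p)))"
    by (subst sweedler_S_sharp) (simp_all add: sym_linear_iff star_linear distrib_left distrib_right)
  finally show ?thesis .
qed

text \<open>The homomorphism of \<open>mult_star_S_sharp\<close> sends each generator
  \<open>S_i\<close> to \<open>S_sharp i\<close>.\<close>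

lemma gen_prod_star_S_sharp:
  "gen_prod I \<star> S_sharp n = (if sum_list I = n then S_sharp_prod I else 0)"
proof (induction I arbitrary: n)
  case Nil
  show ?case
    using gen_star_S_sharp[of 0 n] by (auto simp: S_sharp_prod_def)
next
  case (Cons i I)
  have "gen_prod (i # I) \<star> S_sharp n =
      (\<Sum>p\<le>n. if p = i then S_sharp i * (gen_prod I \<star> S_sharp (n - i)) else 0)"
    unfolding gen_prod_Cons mult_star_S_sharp gen_star_S_sharp by (intro sum.cong refl) simp
  also have "\<dots> = (if i \<le> n then S_sharp i * (gen_prod I \<star> S_sharp (n - i)) else 0)"
    by simp
  also have "\<dots> = (if sum_list (i # I) = n then S_sharp_prod (i # I) else 0)"
    by (auto simp: Cons.IH S_sharp_prod_def)
  finally show ?case .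
qed

section \<open>The spaces \<open>D0\<close>\<close>

lemma subspace_linear_image:
  assumes "sym_linear f" "sym.subspace V"
  shows "sym.subspace (f ` V)"
proof -
  interpret f: Vector_Spaces.linear "(\<cdot>\<^sub>C)" "(\<cdot>\<^sub>C)" f by (rule assms)
  show ?thesis by (rule f.subspace_image[OF assms(2)])
qed

lemma D0_conv_image: "D0 n = (\<lambda>F. F \<star> S_sharp n) ` Sym n"
  by (auto simp: D0_def)

lemma subspace_D0: "sym.subspace (D0 n)"
  unfolding D0_conv_image by (rule subspace_linear_image[OF sym_linear_star_left subspace_Sym])

lemma D0_subset_Sym: "D0 n \<subseteq> Sym n"
  by (auto simp: D0_def star_in_Sym)

text \<open>By \<open>gen_prod_star_S_sharp\<close>, the products \<open>S_sharp_prod J\<close> of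
  weight \<open>n\<close> span \<open>D0 n\<close>.\<close>

lemma D0_linear_eqI:
  assumes "sym_linear f" "sym_linear g" "F \<in> D0 n"
    and "\<And>J. f (S_sharp_prod J) = g (S_sharp_prod J)"
  shows "f F = g F"
proof -
  obtain H where H: "H \<in> Sym n" "F = H \<star> S_sharp n"
    using assms(3) by (auto simp: D0_def)
  have "f (H \<star> S_sharp n) = g (H \<star> S_sharp n)"
    by (rule Sym_linear_eqI[OF _ _ H(1), of "\<lambda>H. f (H \<star> S_sharp n)" "\<lambda>H. g (H \<star> S_sharp n)"])
      (use assms in \<open>simp_all add: sym_linear_iff star_linear gen_prod_star_S_sharp\<close>)
  then show ?thesis by (simp add: H(2))
qed

lemma S_sharp_in_D0: "S_sharp n \<in> D0 n"
  using gen_star_S_sharp[of n n] gen_in_Sym by (force simp: D0_def)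

text \<open>In the splitting of \<open>(F' * G') \<star> S_sharp (m + n)\<close> the degrees leave
  only the term \<open>p = m\<close>.\<close>

lemma D0_mult:
  assumes "F \<in> D0 m" "G \<in> D0 n"
  shows "F * G \<in> D0 (m + n)"
proof -
  obtain F' where F': "F' \<in> Sym m" "F = F' \<star> S_sharp m"
    using assms(1) by (auto simp: D0_def)
  obtain G' where G': "G' \<in> Sym n" "G = G' \<star> S_sharp n"
    using assms(2) by (auto simp: D0_def)
  have "(F' * G') \<star> S_sharp (m + n) = (\<Sum>p\<le>m + n. if p = m then F * G else 0)"
    unfolding mult_star_S_sharp
    by (intro sum.cong refl) (auto simp: F' G' star_diff_degree[OF F'(1) S_sharp_in_Sym])
  then have "F * G = (F' * G') \<star> S_sharp (m + n)"
    by simp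
  then show ?thesis
    using Sym_mult[OF F'(1) G'(1)] by (auto simp: D0_def)
qed

text \<open>\<open>gen 1 \<star>\<close> annihilates every degree except 1, and products of
  \<open>S_sharp\<close> vanish in degree 1; hence a nontrivial left part \<open>X\<close>
  contributes nothing. \<open>P\<close> and \<open>Q\<close> collect the factors already
  split.\<close>

lemma sweedler_S_sharp_prod:
  assumes "P \<in> Sym a"
  shows "sweedler (\<lambda>X Y. (gen 1 \<star> (P * X)) * (F \<star> (Q * Y))) (S_sharp_prod J) =
    (gen 1 \<star> P) * (F \<star> (Q * S_sharp_prod J))"
  using assms
proof (induction J arbitrary: P Q a)
  case Nil
  show ?case by (simp add: S_sharp_prod_def)
next
  case (Cons j J)
  have vanish: "gen 1 \<star> (P * S_sharp p) = 0" if "p > 0" for p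
  proof (cases "p = 1")
    case True
    then show ?thesis by (simp add: S_sharp_1)
  next
    case False
    with that show ?thesis
      by (intro star_diff_degree[OF gen_in_Sym Sym_mult[OF Cons.prems S_sharp_in_Sym]])
        simp
  qed
  have "sweedler (\<lambda>X Y. (gen 1 \<star> (P * X)) * (F \<star> (Q * Y))) (S_sharp_prod (j # J)) =
      (\<Sum>p\<le>j. sweedler (\<lambda>X Y. (gen 1 \<star> (P * (S_sharp p * X))) * (F \<star> (Q * (S_sharp (j - p) * Y))))
        (S_sharp_prod J))"
    unfolding S_sharp_prod_def list.map prod_list.Cons
    by (rule sweedler_S_sharp) (simp_all add: sym_linear_iff star_linear distrib_left distrib_right)
  also have "\<dots> = (\<Sum>p\<le>j. (gen 1 \<star> (P * S_sharp p)) * (F \<star> (Q * S_sharp (j - p) * S_sharp_prod J)))"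
    by (intro sum.cong refl,
        subst Cons.IH[OF Sym_mult[OF Cons.prems S_sharp_in_Sym], symmetric])
      (simp add: mult.assoc)
  also have "\<dots> = (\<Sum>p\<le>j. if p = 0 then (gen 1 \<star> P) * (F \<star> (Q * S_sharp j * S_sharp_prod J)) else 0)"
    by (intro sum.cong refl) (auto simp: vanish simp del: One_nat_def)
  also have "\<dots> = (gen 1 \<star> P) * (F \<star> (Q * S_sharp_prod (j # J)))"
    by (simp add: S_sharp_prod_def mult.assoc)
  finally show ?case .
qed

text \<open>A left factor \<open>S\<^sub>1\<close> acts on \<open>S\<^sub>1\<^sup>b G\<close> like \<open>S\<^sub>1 \<partial>/\<partial>S\<^sub>1\<close>, because \<open>S\<^sub>1\<^sup>\<sharp> = 0\<close> leaves the coproduct of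
  \<open>G\<close> without a left component of degree 1.\<close>

lemma gen_1_mult_star:
  assumes "G \<in> D0 n"
  shows "(gen 1 * F) \<star> (gen 1 ^ b * G) = of_nat b \<cdot>\<^sub>C (gen 1 * (F \<star> (gen 1 ^ (b - 1) * G)))"
proof (rule D0_linear_eqI[OF _ _ assms])
  fix J
  let ?G = "S_sharp_prod J"
  have "(gen 1 * F) \<star> (gen 1 ^ b * ?G) =
      (\<Sum>c\<le>b. of_nat (b choose c) \<cdot>\<^sub>C ((gen 1 \<star> gen 1 ^ c) * (F \<star> (gen 1 ^ (b - c) * ?G))))"
    unfolding mult_star sweedler_gen_1_power sweedler_S_sharp_prod[OF gen_1_power_in_Sym] ..
  \<comment> \<open>Only \<open>c = 1\<close> has the right degree, and \<open>b choose 1\<close> is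
    \<open>b\<close>.\<close>
  also have "\<dots> = (\<Sum>c\<le>b. if c = 1 then of_nat b \<cdot>\<^sub>C (gen 1 * (F \<star> (gen 1 ^ (b - 1) * ?G))) else 0)"
  proof (intro sum.cong refl)
    fix c
    have "gen 1 \<star> gen 1 ^ c = (if c = 1 then gen 1 else 0)"
      using gen_star[OF gen_in_Sym[of 1]] star_diff_degree[OF gen_in_Sym[of 1] gen_1_power_in_Sym[of c]]
      by auto
    then show "of_nat (b choose c) \<cdot>\<^sub>C ((gen 1 \<star> gen 1 ^ c) * (F \<star> (gen 1 ^ (b - c) * ?G))) =
        (if c = 1 then of_nat b \<cdot>\<^sub>C (gen 1 * (F \<star> (gen 1 ^ (b - 1) * ?G))) else 0)"
      by simp
  qed
  \<comment> \<open>For \<open>b = 0\<close> the sum has no term \<open>c = 1\<close>, in agreement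
    with the factor \<open>of_nat b\<close>.\<close>
  also have "\<dots> = of_nat b \<cdot>\<^sub>C (gen 1 * (F \<star> (gen 1 ^ (b - 1) * ?G)))"
    by (cases b) simp_all
  finally show "(gen 1 * F) \<star> (gen 1 ^ b * ?G) = of_nat b \<cdot>\<^sub>C (gen 1 * (F \<star> (gen 1 ^ (b - 1) * ?G)))" .
qed (simp_all add: sym_linear_iff star_linear distrib_left sym.scale_right_distrib mult.commute)

text \<open>Each \<open>S_1\<close> on the left acts as \<open>S_1 \<partial>/\<partial>S_1\<close>,
  so \<open>a\<close> of them produce the falling factorial \<open>b (b-1) ... (b-a+1)\<close>,
  which is 0 for \<open>a > b\<close>.\<close>

lemma gen_1_power_mult_star:
  assumes "G \<in> D0 n"
  shows "(gen 1 ^ a * F) \<star> (gen 1 ^ b * G) =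
    (if a \<le> b then (fact b / fact (b - a)) \<cdot>\<^sub>C (gen 1 ^ a * (F \<star> (gen 1 ^ (b - a) * G))) else 0)"
proof (induction a arbitrary: b)
  case (Suc a)
  have "(gen 1 ^ Suc a * F) \<star> (gen 1 ^ b * G) =
      of_nat b \<cdot>\<^sub>C (gen 1 * ((gen 1 ^ a * F) \<star> (gen 1 ^ (b - 1) * G)))"
    using gen_1_mult_star[OF assms, of "gen 1 ^ a * F" b] by (simp add: mult.assoc)
  also have "\<dots> = (if Suc a \<le> b then
      (fact b / fact (b - Suc a)) \<cdot>\<^sub>C (gen 1 ^ Suc a * (F \<star> (gen 1 ^ (b - Suc a) * G))) else 0)"
    unfolding Suc.IH by (cases b) (simp_all add: mult.assoc)
  finally show ?case .
qed simp

text \<open>The term of index \<open>i\<close> in \<open>S_sharp n\<close> reproduces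
  \<open>S_1^c G\<close> with coefficient \<open>(-1)^i (c choose i)\<close>, so the total is
  \<open>(1 - 1)^c\<close>. Thus \<open>S_sharp n\<close> is a left unit on \<open>D0 n\<close> and
  kills what carries a positive power of \<open>S_1\<close>.\<close>

lemma S_sharp_star:
  assumes "G \<in> D0 m" "c + m = n"
  shows "S_sharp n \<star> (gen 1 ^ c * G) = (if c = 0 then G else 0)"
proof -
  have "S_sharp n \<star> (gen 1 ^ c * G) =
      (\<Sum>i\<le>n. ((-1) ^ i / fact i) \<cdot>\<^sub>C ((gen 1 ^ i * gen (n - i)) \<star> (gen 1 ^ c * G)))"
    by (simp add: S_sharp_def star_sum_left star_scale_left)
  also have "\<dots> = (\<Sum>i\<le>n. ((-1) ^ i * of_nat (c choose i)) \<cdot>\<^sub>C (gen 1 ^ c * G))"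
  proof (intro sum.cong refl)
    fix i
    show "((-1) ^ i / fact i) \<cdot>\<^sub>C ((gen 1 ^ i * gen (n - i)) \<star> (gen 1 ^ c * G)) =
        ((-1) ^ i * of_nat (c choose i)) \<cdot>\<^sub>C (gen 1 ^ c * G)"
    proof (cases "i \<le> c")
      case True
      have "gen 1 ^ (c - i) * G \<in> Sym (n - i)"
        using Sym_mult[OF gen_1_power_in_Sym[of "c - i"], of G m] assms True D0_subset_Sym
        by auto
      then have "gen (n - i) \<star> (gen 1 ^ (c - i) * G) = gen 1 ^ (c - i) * G"
        by (rule gen_star)
      moreover have "gen 1 ^ i * (gen 1 ^ (c - i) * G) = gen 1 ^ c * G"
        using True by (simp flip: mult.assoc power_add)
      ultimately show ?thesis
        using True by (simp add: gen_1_power_mult_star[OF assms(1)] binomial_fact del: One_nat_def)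
    next
      case False
      then show ?thesis
        by (simp add: gen_1_power_mult_star[OF assms(1)] binomial_eq_0 del: One_nat_def)
    qed
  qed
  also have "\<dots> = (\<Sum>i\<le>c. (-1) ^ i * of_nat (c choose i)) \<cdot>\<^sub>C (gen 1 ^ c * G)"
    unfolding sym.scale_sum_left using assms(2)
    by (intro sum.mono_neutral_right) (auto simp: binomial_eq_0)
  also have "\<dots> = (if c = 0 then G else 0)"
    using choose_alternating_sum[of c, where 'a = complex] by (cases "c = 0") simp_all
  finally show ?thesis .
qed

lemma S_sharp_star_D0: "G \<in> D0 n \<Longrightarrow> S_sharp n \<star> G = G"
  using S_sharp_star[of G n 0 n] by simp

text \<open>\<open>S_sharp n\<close> lies in \<open>D0 n\<close>, hence is idempotent, and every
  element of \<open>D0 n\<close> has it as a right factor.\<close>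

lemma D0_star_S_sharp: "F \<in> D0 n \<Longrightarrow> F \<star> S_sharp n = F"
  by (auto simp: D0_def star_assoc S_sharp_star_D0[OF S_sharp_in_D0])

lemma D0_star:
  assumes "F \<in> D0 n" "G \<in> D0 n"
  shows "F \<star> G \<in> D0 n"
proof -
  have "F \<star> G = (F \<star> G) \<star> S_sharp n"
    by (simp add: star_assoc D0_star_S_sharp[OF assms(2)])
  moreover have "F \<star> G \<in> Sym n"
    using assms(1) D0_subset_Sym by (auto intro: star_in_Sym)
  ultimately show ?thesis
    by (auto simp: D0_def)
qed

text \<open>For \<open>a > b\<close> the powers of \<open>S_1\<close> on the left exhaust those on
  the right. For \<open>a < b\<close> a positive power remains on the right, and it is killed by the
  \<open>S_sharp m\<close> that \<open>F\<close> absorbs.\<close>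

lemma graded_star:
  assumes "F \<in> D0 m" "G \<in> D0 l" "a + m = b + l"
  shows "(gen 1 ^ a * F) \<star> (gen 1 ^ b * G) = (if a = b then fact a \<cdot>\<^sub>C (gen 1 ^ a * (F \<star> G)) else 0)"
proof -
  have "F \<star> (gen 1 ^ (b - a) * G) = 0" if "a < b"
  proof -
    have "F \<star> (gen 1 ^ (b - a) * G) = F \<star> (S_sharp m \<star> (gen 1 ^ (b - a) * G))"
      by (simp add: D0_star_S_sharp[OF assms(1)] flip: star_assoc)
    also have "\<dots> = 0"
      using that assms(3) by (subst S_sharp_star[OF assms(2)]) auto
    finally show ?thesis .
  qed
  then show ?thesis
    by (auto simp: gen_1_power_mult_star[OF assms(2)] simp del: One_nat_def)
qed

section \<open>The spaces of the theorem\<close>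

lemma sum_subspaces_eq_span:
  assumes "finite T" "\<And>i. i \<in> T \<Longrightarrow> sym.subspace (A i)"
  shows "{\<Sum>i\<in>T. g i | g. \<forall>i\<in>T. g i \<in> A i} = sym.span (\<Union>i\<in>T. A i)" (is "?S = _")
proof
  show "?S \<subseteq> sym.span (\<Union>i\<in>T. A i)"
    by (clarify, intro sym.span_sum sym.span_base) auto
  have "sym.subspace ?S"
    unfolding sym.subspace_def
  proof (intro conjI allI ballI)
    show "0 \<in> ?S"
      by (rule CollectI, rule exI[of _ "\<lambda>_. 0"]) (use assms(2) sym.subspace_0 in auto)
  next
    fix x y assume "x \<in> ?S" "y \<in> ?S"
    then obtain g h where "x = (\<Sum>i\<in>T. g i)" "\<forall>i\<in>T. g i \<in> A i"
      "y = (\<Sum>i\<in>T. h i)" "\<forall>i\<in>T. h i \<in> A i"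
      by blast
    then show "x + y \<in> ?S"
      using sym.subspace_add[OF assms(2)]
      by (intro CollectI exI[of _ "\<lambda>i. g i + h i"]) (auto simp: sum.distrib)
  next
    fix c x assume "x \<in> ?S"
    then obtain g where "x = (\<Sum>i\<in>T. g i)" "\<forall>i\<in>T. g i \<in> A i"
      by blast
    then show "c \<cdot>\<^sub>C x \<in> ?S"
      using sym.subspace_scale[OF assms(2)]
      by (intro CollectI exI[of _ "\<lambda>i. c \<cdot>\<^sub>C g i"]) (auto simp: sym.scale_sum_right)
  qed
  moreover have "x \<in> ?S" if "i \<in> T" "x \<in> A i" for i x
    using that assms sym.subspace_0[OF assms(2)]
    by (intro CollectI exI[of _ "\<lambda>j. if j = i then x else 0"]) auto
  ultimately show "sym.span (\<Union>i\<in>T. A i) \<subseteq> ?S"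
    by (intro sym.span_minimal) auto
qed

text \<open>The analogue of \<open>D_summand\<close> with \<open>S_1^a\<close> in place of
  \<open>S_a\<close>; for different \<open>a\<close> these spaces multiply to 0 by
  \<open>graded_star\<close>.\<close>

definition graded :: "nat \<Rightarrow> nat \<Rightarrow> sym set"
  where "graded n a = {gen 1 ^ a * F | F. F \<in> D0 (n - a)}"

lemma subspace_graded: "sym.subspace (graded n a)"
  using subspace_linear_image[OF sym_linear_mult_left subspace_D0]
  by (simp add: graded_def image_def setcompr_eq_image)

lemma subspace_D_summand: "sym.subspace (D_summand n a)"
  using subspace_linear_image[OF sym_linear_mult_left subspace_D0]
  by (simp add: D_summand_def setcompr_eq_image)

text \<open>The scalar and \<open>S_sharp\<close> are grouped with \<open>F\<close>, so that for
  \<open>F\<close> in \<open>D0 (n - j)\<close> the term of index \<open>i\<close> visibly lies in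
  \<open>graded n i\<close>.\<close>

lemma gen_mult_D0:
  "gen j * F = (\<Sum>i\<le>j. gen 1 ^ i * ((1 / fact i) \<cdot>\<^sub>C (S_sharp (j - i) * F)))"
  by (subst gen_conv_S_sharp) (simp add: sum_distrib_right mult.assoc)

lemma S_sharp_mult_in_D0:
  assumes "F \<in> D0 (n - j)" "i \<le> j" "j \<le> n"
  shows "c \<cdot>\<^sub>C (S_sharp (j - i) * F) \<in> D0 (n - i)"
  using sym.subspace_scale[OF subspace_D0 D0_mult[OF S_sharp_in_D0[of "j - i"] assms(1)]] assms(2,3)
  by simp

lemma D_space_eq_span_D_summand: "D_space n k = sym.span (\<Union>j\<le>min k n. D_summand n j)"
  unfolding D_space_def using sum_subspaces_eq_span[of "{..min k n}", OF _ subspace_D_summand]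
  by (simp add: Ball_def)

text \<open>The passage from \<open>S_1^j F\<close> to \<open>S_j F\<close> is triangular with
  diagonal \<open>1/j!\<close>: all other terms have lower powers of \<open>S_1\<close>. Strong
  induction on \<open>j\<close> inverts it.\<close>

lemma D_space_eq_span_graded: "D_space n k = sym.span (\<Union>a\<le>min k n. graded n a)"
proof -
  let ?K = "min k n"
  have "gen j * F \<in> sym.span (\<Union>a\<le>?K. graded n a)" if "j \<le> ?K" "F \<in> D0 (n - j)" for j F
    unfolding gen_mult_D0
  proof (intro sym.span_sum sym.span_base UN_I)
    fix i assume "i \<in> {..j}"
    then show "gen 1 ^ i * ((1 / fact i) \<cdot>\<^sub>C (S_sharp (j - i) * F)) \<in> graded n i" "i \<in> {..?K}"
      using that S_sharp_mult_in_D0[OF that(2), of i] unfolding graded_def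
      by (fastforce simp del: scale_mult_right One_nat_def)+
  qed
  then have "(\<Union>j\<le>?K. D_summand n j) \<subseteq> sym.span (\<Union>a\<le>?K. graded n a)"
    by (auto simp: D_summand_def)
  moreover have "gen 1 ^ j * F \<in> sym.span (\<Union>j\<le>?K. D_summand n j)"
    if "j \<le> ?K" "F \<in> D0 (n - j)" for j F
    using that
  proof (induction j arbitrary: F rule: less_induct)
    case (less j)
    let ?t = "\<lambda>i. gen 1 ^ i * ((1 / fact i) \<cdot>\<^sub>C (S_sharp (j - i) * F))"
    have "gen j * F \<in> sym.span (\<Union>j\<le>?K. D_summand n j)"
      using less.prems by (intro sym.span_base) (auto simp: D_summand_def)
    moreover have "?t i \<in> sym.span (\<Union>j\<le>?K. D_summand n j)" if "i < j" for i
      using that less.prems by (intro less.IH S_sharp_mult_in_D0) auto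
    \<comment> \<open>The term \<open>i = j\<close> contains \<open>S_sharp 0 = 1\<close>.\<close>
    moreover have "gen j * F = (\<Sum>i<j. ?t i) + (1 / fact j) \<cdot>\<^sub>C (gen 1 ^ j * F)"
      by (subst gen_mult_D0) (simp add: lessThan_Suc_atMost[symmetric])
    then have "gen 1 ^ j * F = fact j \<cdot>\<^sub>C (gen j * F - (\<Sum>i<j. ?t i))"
      by simp
    ultimately show ?case
      by (auto intro!: sym.span_scale sym.span_diff sym.span_sum simp del: scale_mult_right)
  qed
  then have "(\<Union>a\<le>?K. graded n a) \<subseteq> sym.span (\<Union>j\<le>?K. D_summand n j)"
    by (auto simp: graded_def)
  ultimately show ?thesis
    unfolding D_space_eq_span_D_summand by (simp add: sym.span_eq)
qed

lemma D_space_conv_graded: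
  "D_space n k = {\<Sum>a\<le>min k n. gen 1 ^ a * f a | f. \<forall>a\<le>min k n. f a \<in> D0 (n - a)}"
proof -
  have "D_space n k = {\<Sum>a\<le>min k n. g a | g. \<forall>a\<le>min k n. g a \<in> graded n a}"
    unfolding D_space_eq_span_graded
    using sum_subspaces_eq_span[of "{..min k n}", OF _ subspace_graded] by (simp add: Ball_def)
  also have "\<dots> = {\<Sum>a\<le>min k n. gen 1 ^ a * f a | f. \<forall>a\<le>min k n. f a \<in> D0 (n - a)}"
  proof (intro equalityI subsetI; clarify)
    fix g assume "\<forall>a\<le>min k n. g a \<in> graded n a"
    then have "\<forall>a. \<exists>F. a \<le> min k n \<longrightarrow> F \<in> D0 (n - a) \<and> g a = gen 1 ^ a * F"
      by (auto simp: graded_def)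
    then obtain f where "\<forall>a\<le>min k n. f a \<in> D0 (n - a) \<and> g a = gen 1 ^ a * f a"
      by metis
    then show "\<exists>f. (\<Sum>a\<le>min k n. g a) = (\<Sum>a\<le>min k n. gen 1 ^ a * f a) \<and>
        (\<forall>a\<le>min k n. f a \<in> D0 (n - a))"
      by (intro exI[of _ f]) simp
  next
    fix f assume "\<forall>a\<le>min k n. f a \<in> D0 (n - a)"
    then show "\<exists>g. (\<Sum>a\<le>min k n. gen 1 ^ a * f a) = (\<Sum>a\<le>min k n. g a) \<and>
        (\<forall>a\<le>min k n. g a \<in> graded n a)"
      by (intro exI[of _ "\<lambda>a. gen 1 ^ a * f a"]) (auto simp: graded_def)
  qed
  finally show ?thesis .
qed

text \<open>Components of different index multiply to 0, so the product is componentwise up to the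
  factor \<open>a!\<close>.\<close>

lemma D_space_star:
  assumes "\<forall>a\<le>min k n. f a \<in> D0 (n - a)" "\<forall>a\<le>min k n. g a \<in> D0 (n - a)"
  shows "(\<Sum>a\<le>min k n. gen 1 ^ a * f a) \<star> (\<Sum>b\<le>min k n. gen 1 ^ b * g b) =
    (\<Sum>a\<le>min k n. gen 1 ^ a * (fact a \<cdot>\<^sub>C (f a \<star> g a)))"
proof -
  have "(gen 1 ^ a * f a) \<star> (\<Sum>b\<le>min k n. gen 1 ^ b * g b) = gen 1 ^ a * (fact a \<cdot>\<^sub>C (f a \<star> g a))"
    if "a \<le> min k n" for a
  proof -
    have "(gen 1 ^ a * f a) \<star> (\<Sum>b\<le>min k n. gen 1 ^ b * g b) =
        (\<Sum>b\<le>min k n. if b = a then gen 1 ^ a * (fact a \<cdot>\<^sub>C (f a \<star> g a)) else 0)"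
      unfolding star_sum_right
    proof (intro sum.cong refl)
      fix b assume "b \<in> {..min k n}"
      then have "(gen 1 ^ a * f a) \<star> (gen 1 ^ b * g b) =
          (if a = b then fact a \<cdot>\<^sub>C (gen 1 ^ a * (f a \<star> g b)) else 0)"
        using that assms by (intro graded_star[of _ "n - a" _ "n - b"]) auto
      then show "(gen 1 ^ a * f a) \<star> (gen 1 ^ b * g b) =
          (if b = a then gen 1 ^ a * (fact a \<cdot>\<^sub>C (f a \<star> g a)) else 0)"
        by auto
    qed
    with that show ?thesis by simp
  qed
  then show ?thesis
    by (simp add: star_sum_left)
qed

text \<open>The coefficient \<open>1/a!\<close> is moved into the component, where it compensates
  the factor \<open>a!\<close> of \<open>D_space_star\<close>.\<close>

lemma P_unit_conv_graded:
  "P_unit n k = (\<Sum>a\<le>min k n. gen 1 ^ a * ((1 / fact a) \<cdot>\<^sub>C S_sharp (n - a)))"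
  by (simp add: P_unit_def)

section \<open>Directness of the sum\<close>

lemma composition_add_left_cancel: "I + J = I + K \<Longrightarrow> J = K" for I J K :: composition
  by transfer simp

text \<open>Words are left cancellative, so the coefficient of \<open>?I + J\<close> in
  \<open>S_1 F\<close> is that of \<open>J\<close> in \<open>F\<close>.\<close>

lemma gen_1_mult_eq_0:
  assumes "gen 1 * F = 0"
  shows "F = 0"
proof (rule poly_mapping_eqI)
  fix J
  let ?I = "Composition [1]"
  have "gen 1 * F = (\<Sum>K\<in>Poly_Mapping.keys F. Poly_Mapping.single (?I + K) (Poly_Mapping.lookup F K))"
    by (subst (2) sum_single) (simp add: sum_distrib_left gen_def mult_single)
  then have "Poly_Mapping.lookup (gen 1 * F) (?I + J) =
      (\<Sum>K\<in>Poly_Mapping.keys F. if K = J then Poly_Mapping.lookup F J else 0)"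
    by (simp only: lookup_sum, intro sum.cong refl)
      (auto simp: lookup_single when_def dest: composition_add_left_cancel)
  then show "Poly_Mapping.lookup F J = Poly_Mapping.lookup 0 J"
    using assms by (auto simp: in_keys_iff split: if_splits)
qed

lemma gen_1_power_mult_eq_0: "gen 1 ^ a * F = 0 \<Longrightarrow> F = 0"
  by (induction a) (use gen_1_mult_eq_0 in \<open>auto simp: mult.assoc simp del: One_nat_def\<close>)

text \<open>The left factor extracts the \<open>S_1^a\<close> component. The expansion of
  \<open>S_l F\<close> has powers \<open>S_1^i\<close> with \<open>i \<le> l \<le> a\<close>, so
  \<open>i = a\<close> forces \<open>l = a\<close>, and then \<open>S_sharp (l - i)\<close> is
  1.\<close>

lemma graded_star_gen_mult:
  assumes "F \<in> D0 (n - l)" "l \<le> a" "a \<le> n"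
  shows "(gen 1 ^ a * S_sharp (n - a)) \<star> (gen l * F) = (if l = a then gen 1 ^ a * F else 0)"
proof -
  have "(gen 1 ^ a * S_sharp (n - a)) \<star> (gen l * F) = (\<Sum>i\<le>l. if i = a then gen 1 ^ a * F else 0)"
    unfolding gen_mult_D0 star_sum_right
  proof (intro sum.cong refl)
    fix i assume "i \<in> {..l}"
    then have i: "(1 / fact i) \<cdot>\<^sub>C (S_sharp (l - i) * F) \<in> D0 (n - i)"
      using assms by (intro S_sharp_mult_in_D0) auto
    have "(gen 1 ^ a * S_sharp (n - a)) \<star> (gen 1 ^ i * ((1 / fact i) \<cdot>\<^sub>C (S_sharp (l - i) * F))) =
        (if a = i then fact a \<cdot>\<^sub>C (gen 1 ^ a * (S_sharp (n - a) \<star> ((1 / fact i) \<cdot>\<^sub>C (S_sharp (l - i) * F)))) else 0)"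
      using assms \<open>i \<in> {..l}\<close> by (intro graded_star[OF S_sharp_in_D0 i]) auto
    also have "\<dots> = (if i = a then gen 1 ^ a * F else 0)"
      using assms \<open>i \<in> {..l}\<close> S_sharp_star_D0[OF i] by auto
    finally show "(gen 1 ^ a * S_sharp (n - a)) \<star> (gen 1 ^ i * ((1 / fact i) \<cdot>\<^sub>C (S_sharp (l - i) * F))) =
        (if i = a then gen 1 ^ a * F else 0)" .
  qed
  then show ?thesis using assms(2) by simp
qed

text \<open>Let \<open>a\<close> be the largest index of a nonzero term. Multiplying the vanishing
  sum by \<open>S_1^a S_sharp (n - a)\<close> leaves only \<open>S_1^a F\<close>, and
  \<open>S_1\<close> can be cancelled.\<close>

lemma D_summand_independent:
  assumes "\<forall>j\<le>min k n. g j \<in> D_summand n j" "(\<Sum>j\<le>min k n. g j) = 0" "j \<le> min k n"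
  shows "g j = 0"
proof (rule ccontr)
  let ?J = "{j. j \<le> min k n \<and> g j \<noteq> 0}"
  assume "g j \<noteq> 0"
  define a where "a = Max ?J"
  have "finite ?J" "?J \<noteq> {}"
    using \<open>g j \<noteq> 0\<close> assms(3) by auto
  then have a: "a \<le> min k n" "g a \<noteq> 0"
    using Max_in[of ?J] unfolding a_def by auto
  have above: "g l = 0" if "a < l" "l \<le> min k n" for l
  proof (rule ccontr)
    assume "g l \<noteq> 0"
    with that(2) have "l \<le> Max ?J"
      by (intro Max_ge \<open>finite ?J\<close>) simp
    with that(1) show False
      by (simp add: a_def)
  qed
  have "(\<Sum>l\<le>a. g l) = (\<Sum>l\<le>min k n. g l)"
    using a(1) above by (intro sum.mono_neutral_left) auto
  then have "(\<Sum>l\<le>a. (gen 1 ^ a * S_sharp (n - a)) \<star> g l) = 0"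
    using assms(2) by (simp flip: star_sum_right)
  obtain F where F: "F \<in> D0 (n - a)" "g a = gen a * F"
    using assms(1) a(1) by (auto simp: D_summand_def)
  have "(gen 1 ^ a * S_sharp (n - a)) \<star> g l = (if l = a then gen 1 ^ a * F else 0)" if l: "l \<le> a" for l
  proof -
    have "g l \<in> D_summand n l"
      using assms(1) a(1) l by simp
    then obtain H where "H \<in> D0 (n - l)" "g l = gen l * H"
      by (auto simp: D_summand_def)
    \<comment> \<open>For \<open>l = a\<close> one only knows \<open>gen a * H = gen a * F\<close>,
      so that case goes through \<open>F\<close> itself.\<close>
    then show ?thesis
      using graded_star_gen_mult[of H n l a] graded_star_gen_mult[OF F(1), of a] F(2) a(1) l
      by auto
  qed
  then have "(\<Sum>l\<le>a. (gen 1 ^ a * S_sharp (n - a)) \<star> g l) = gen 1 ^ a * F"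
    by simp
  with \<open>(\<Sum>l\<le>a. (gen 1 ^ a * S_sharp (n - a)) \<star> g l) = 0\<close> have "F = 0"
    using gen_1_power_mult_eq_0 by simp
  then show False
    using a(2) F(2) by simp
qed

theorem theorem2p9:
  fixes n k :: nat
  shows "D_space n k \<subseteq> Sym n
    \<and> is_direct_sum (D_space n k) (D_summand n) {..min k n}
    \<and> (\<forall>F\<in>D_space n k. \<forall>G\<in>D_space n k. F \<star> G \<in> D_space n k)
    \<and> unital_algebra (D_space n k) (\<star>) (P_unit n k)"
proof (intro conjI)
  have subspace: "sym.subspace (D_space n k)"
    unfolding D_space_eq_span_graded by (rule sym.subspace_span)
  show "D_space n k \<subseteq> Sym n"
    unfolding D_space_conv_graded
  proof clarify
    fix f assume f: "\<forall>a\<le>min k n. f a \<in> D0 (n - a)"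
    show "(\<Sum>a\<le>min k n. gen 1 ^ a * f a) \<in> Sym n"
    proof (rule sym.subspace_sum[OF subspace_Sym])
      fix a assume "a \<in> {..min k n}"
      then show "gen 1 ^ a * f a \<in> Sym n"
        using Sym_mult[OF gen_1_power_in_Sym[of a], of "f a" "n - a"] f D0_subset_Sym
        by auto
    qed
  qed
  show "is_direct_sum (D_space n k) (D_summand n) {..min k n}"
    unfolding is_direct_sum_def using D_summand_independent[of k n]
    by (simp add: subspace_D_summand D_space_def Ball_def)
  show closed: "\<forall>F\<in>D_space n k. \<forall>G\<in>D_space n k. F \<star> G \<in> D_space n k"
  proof (intro ballI)
    fix F G assume "F \<in> D_space n k" "G \<in> D_space n k"
    then obtain f g where fg: "\<forall>a\<le>min k n. f a \<in> D0 (n - a)" "\<forall>a\<le>min k n. g a \<in> D0 (n - a)"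
      and FG: "F = (\<Sum>a\<le>min k n. gen 1 ^ a * f a)" "G = (\<Sum>a\<le>min k n. gen 1 ^ a * g a)"
      unfolding D_space_conv_graded by blast
    have "\<forall>a\<le>min k n. fact a \<cdot>\<^sub>C (f a \<star> g a) \<in> D0 (n - a)"
      using fg by (auto intro: D0_star sym.subspace_scale[OF subspace_D0])
    then show "F \<star> G \<in> D_space n k"
      unfolding FG D_space_star[OF fg] unfolding D_space_conv_graded
      by (intro CollectI exI[of _ "\<lambda>a. fact a \<cdot>\<^sub>C (f a \<star> g a)"] conjI refl)
  qed
  have unit_D0: "\<forall>a\<le>min k n. (1 / fact a) \<cdot>\<^sub>C S_sharp (n - a) \<in> D0 (n - a)"
    by (auto intro: sym.subspace_scale[OF subspace_D0] S_sharp_in_D0)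
  have unit_in: "P_unit n k \<in> D_space n k"
    unfolding P_unit_conv_graded D_space_conv_graded using unit_D0
    by (intro CollectI exI[of _ "\<lambda>a. (1 / fact a) \<cdot>\<^sub>C S_sharp (n - a)"] conjI refl)
  have unit: "P_unit n k \<star> F = F" "F \<star> P_unit n k = F" if F: "F \<in> D_space n k" for F
  proof -
    obtain f where f: "\<forall>a\<le>min k n. f a \<in> D0 (n - a)" "F = (\<Sum>a\<le>min k n. gen 1 ^ a * f a)"
      using F unfolding D_space_conv_graded by blast
    \<comment> \<open>In each component \<open>a!\<close> and \<open>1/a!\<close> cancel, and
      \<open>S_sharp (n - a)\<close> is a two-sided unit on \<open>D0 (n - a)\<close>.\<close>
    show "P_unit n k \<star> F = F" "F \<star> P_unit n k = F"
      unfolding f(2) P_unit_conv_graded D_space_star[OF unit_D0 f(1)] D_space_star[OF f(1) unit_D0]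
      using f(1) by (simp_all add: star_scale_left star_scale_right S_sharp_star_D0 D0_star_S_sharp)
  qed
  have ring: "ring \<lparr>carrier = D_space n k, monoid.mult = (\<star>), one = P_unit n k, ring.zero = 0, add = (+)\<rparr>"
  proof (intro ringI abelian_groupI monoidI)
    fix F assume "F \<in> carrier \<lparr>carrier = D_space n k, monoid.mult = (\<star>), one = P_unit n k, ring.zero = 0, add = (+)\<rparr>"
    then have "- F \<in> D_space n k"
      using sym.subspace_neg[OF subspace] by simp
    then show "\<exists>G\<in>carrier \<lparr>carrier = D_space n k, monoid.mult = (\<star>), one = P_unit n k, ring.zero = 0, add = (+)\<rparr>.
        G \<oplus>\<^bsub>\<lparr>carrier = D_space n k, monoid.mult = (\<star>), one = P_unit n k, ring.zero = 0, add = (+)\<rparr>\<^esub> F =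
        \<zero>\<^bsub>\<lparr>carrier = D_space n k, monoid.mult = (\<star>), one = P_unit n k, ring.zero = 0, add = (+)\<rparr>\<^esub>"
      by (intro bexI[of _ "- F"]) simp_all
  qed (use closed unit unit_in sym.subspace_0[OF subspace] sym.subspace_add[OF subspace] in
      \<open>auto simp: star_assoc star_linear add_ac\<close>)
  show "unital_algebra (D_space n k) (\<star>) (P_unit n k)"
    unfolding unital_algebra_def using subspace ring by (simp add: star_linear)
qed

end
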